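(* Let $0<\nu\le1$. Then: (iv) for every symmetric density $f\in\mathcal{F}_{J_{t_\nu}}$, $$\mathrm{ARE}_f(\phi_{t_\nu}/\phi_{\rm W})\;\le\;\frac{\pi\,\Gamma^2\!\left(\frac{\nu}{2}\right)(\nu+3)(\nu+1)}{12\,\nu\,\Gamma^2\!\left(\frac{\nu+1}{2}\right)};$$ (v) for every symmetric density $f\in\mathcal{F}_{J_{t_\nu}}\cap\mathcal{F}_{J_{\rm vdW}}$, $$\mathrm{ARE}_f(\phi_{t_\nu}/\phi_{\rm vdW})\;\le\;\frac{\Gamma^2\!\left(\frac{\nu}{2}\right)(\nu+3)(\nu+1)}{2\,\nu\,\Gamma^2\!\left(\frac{\nu+1}{2}\right)}.$$
   Context: $\mathcal{F}$ is the class of probability densities $f$ on $\mathbb{R}$ (with distribution function $F$ and quantile function $F^{-1}$) that admit a weak derivative $f'$ and are such that, with $\varphi_f:=-f'/f$, the Fisher information for location $\mathcal{I}(f)=\int_0^1\varphi_f^2(F^{-1}(u))\,du$ is finite. (One may take $f$ absolutely continuous with a.e. derivative $f'$.) Let $\mathcal{F}_0:=\{f\in\mathcal{F}:\lim_{x\to\pm\infty}f(x)=0\}$ and, for a differentiable score function $J$ on $(0,1)$, $\mathcal{F}_J:=\{f\in\mathcal{F}_0:\lim_{x\to\pm\infty}J(F(x))f(x)=0\}$. A density is symmetric if $f(-x)=f(x)$. For a square-integrable score function $J$ on $(0,1)$ (monotone, or the difference of two monotone functions), let $\mathcal{K}(J):=\int_0^1J^2(u)\,du$ and $\mathcal{K}(J,f):=\int_0^1J(u)\varphi_f(F^{-1}(u))\,du$.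 The asymptotic relative efficiency, under $f$, of the rank test $\phi_{J}$ based on scores $J$ with respect to the rank test $\phi_{\tilde J}$ based on scores $\tilde J$ (for location/regression problems) is $$\mathrm{ARE}_f(\phi_J/\phi_{\tilde J})=\frac{\mathcal{K}(\tilde J)}{\mathcal{K}(J)}\left(\frac{\mathcal{K}(J,f)}{\mathcal{K}(\tilde J,f)}\right)^2 .$$ The tests involved are: $\phi_{\rm W}$ (Wilcoxon), with scores $J_{\rm W}(u)=u-1/2$; $\phi_{\rm vdW}$ (van der Waerden), with scores $J_{\rm vdW}(u)=\Phi^{-1}(u)$, where $\Phi$ is the standard normal distribution function; and $\phi_{t_\nu}$ (Student scores), with scores $$J_{t_\nu}(u)=\frac{(\nu+1)F_{t_\nu}^{-1}(u)}{\nu+\big(F_{t_\nu}^{-1}(u)\big)^2},\qquad 0<u<1,$$ where $F_{t_\nu}^{-1}$ is the quantile function of the Student distribution with $\nu$ degrees of freedom. $\Gamma$ is the Gamma function. *)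

theory Defs
  imports "HOL-Probability.Probability"
begin

subsection \<open>Densities, distribution functions, quantile functions\<close>

definition prob_density :: "(real \<Rightarrow> real) \<Rightarrow> bool" where
  "prob_density f \<longleftrightarrow>
     (\<forall>x. 0 \<le> f x) \<and> integrable lborel f \<and> (LINT x|lborel. f x) = 1"

definition dist_fun :: "(real \<Rightarrow> real) \<Rightarrow> real \<Rightarrow> real" where
  "dist_fun f = cdf (density lborel (\<lambda>x. ennreal (f x)))"

text \<open>The generalized inverse of a distribution function. It is only meaningful
  (and only used) for arguments in the open unit interval.\<close>

definition quantile :: "(real \<Rightarrow> real) \<Rightarrow> real \<Rightarrow> real" where
  "quantile F u = Inf {x. u \<le> F x}"

definition symmetric_density :: "(real \<Rightarrow> real) \<Rightarrow> bool" where
  "symmetric_density f \<longleftrightarrow> (\<forall>x. f (- x) = f x)"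

subsection \<open>Weak derivatives\<close>

definition test_function :: "(real \<Rightarrow> real) \<Rightarrow> bool" where
  "test_function \<psi> \<longleftrightarrow>
     (\<forall>n x. (deriv ^^ n) \<psi> differentiable (at x)) \<and>
     (\<exists>R. \<forall>x. \<bar>x\<bar> > R \<longrightarrow> \<psi> x = 0)"

definition locally_integrable :: "(real \<Rightarrow> real) \<Rightarrow> bool" where
  "locally_integrable g \<longleftrightarrow> (\<forall>a b. set_integrable lborel {a..b} g)"

definition has_weak_derivative :: "(real \<Rightarrow> real) \<Rightarrow> (real \<Rightarrow> real) \<Rightarrow> bool" where
  "has_weak_derivative f g \<longleftrightarrow>
     locally_integrable f \<and> locally_integrable g \<and>
     (\<forall>\<psi>. test_function \<psi> \<longrightarrow>
        (LINT x|lborel. f x * deriv \<psi> x) = - (LINT x|lborel. g x * \<psi> x))"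

text \<open>Weak derivatives are unique up to Lebesgue-null sets. The version picked by the
  choice operator is immaterial, because below it is only used inside integrals with
  respect to the absolutely continuous distribution with density \<^term>\<open>f\<close>. When
  \<^term>\<open>f\<close> is absolutely continuous, the a.e. derivative is one such version.\<close>

definition weak_deriv :: "(real \<Rightarrow> real) \<Rightarrow> real \<Rightarrow> real" where
  "weak_deriv f = (SOME g. has_weak_derivative f g)"

subsection \<open>Location score, Fisher information, classes of densities\<close>

text \<open>On the set where \<^term>\<open>f\<close> vanishes the quotient is 0 by the division convention;
  that set has probability 0 under \<^term>\<open>f\<close>.\<close>

definition loc_score :: "(real \<Rightarrow> real) \<Rightarrow> real \<Rightarrow> real" where
  "loc_score f x = - weak_deriv f x / f x"

definition fisher_info :: "(real \<Rightarrow> real) \<Rightarrow> ennreal" where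
  "fisher_info f =
     (\<integral>\<^sup>+u\<in>{0<..<1}. ennreal ((loc_score f (quantile (dist_fun f) u))\<^sup>2) \<partial>lborel)"

definition class_F :: "(real \<Rightarrow> real) set" where
  "class_F = {f. prob_density f \<and> (\<exists>g. has_weak_derivative f g) \<and> fisher_info f < \<infinity>}"

definition class_F0 :: "(real \<Rightarrow> real) set" where
  "class_F0 = {f \<in> class_F. (f \<longlongrightarrow> 0) at_top \<and> (f \<longlongrightarrow> 0) at_bot}"

definition class_FJ :: "(real \<Rightarrow> real) \<Rightarrow> (real \<Rightarrow> real) set" where
  "class_FJ J = {f \<in> class_F0.
     ((\<lambda>x. J (dist_fun f x) * f x) \<longlongrightarrow> 0) at_top \<and>
     ((\<lambda>x. J (dist_fun f x) * f x) \<longlongrightarrow> 0) at_bot}"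

subsection \<open>Asymptotic relative efficiency of rank tests\<close>

definition K_score :: "(real \<Rightarrow> real) \<Rightarrow> real" where
  "K_score J = (LINT u:{0<..<1}|lborel. (J u)\<^sup>2)"

definition K_cross :: "(real \<Rightarrow> real) \<Rightarrow> (real \<Rightarrow> real) \<Rightarrow> real" where
  "K_cross J f =
     (LINT u:{0<..<1}|lborel. J u * loc_score f (quantile (dist_fun f) u))"

text \<open>Efficiency, under \<^term>\<open>f\<close>, of the test based on scores \<^term>\<open>J\<close> with respect to
  the test based on scores \<^term>\<open>J'\<close>.\<close>

definition ARE :: "(real \<Rightarrow> real) \<Rightarrow> (real \<Rightarrow> real) \<Rightarrow> (real \<Rightarrow> real) \<Rightarrow> real" where
  "ARE f J J' = K_score J' / K_score J * (K_cross J f / K_cross J' f)\<^sup>2"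

subsection \<open>Score functions\<close>

definition J_W :: "real \<Rightarrow> real" where
  "J_W u = u - 1 / 2"

definition J_vdW :: "real \<Rightarrow> real" where
  "J_vdW u = quantile (dist_fun std_normal_density) u"

definition student_density :: "real \<Rightarrow> real \<Rightarrow> real" where
  "student_density \<nu> x =
     Gamma ((\<nu> + 1) / 2) / (sqrt (\<nu> * pi) * Gamma (\<nu> / 2)) *
     (1 + x\<^sup>2 / \<nu>) powr (- (\<nu> + 1) / 2)"

definition J_t :: "real \<Rightarrow> real \<Rightarrow> real" where
  "J_t \<nu> u =
     (let q = quantile (dist_fun (student_density \<nu>)) u
      in (\<nu> + 1) * q / (\<nu> + q\<^sup>2))"

end

theory Submission
  imports Defs
begin

text \<open>If \<open>D\<close> is nondecreasing and square-integrable on \<open>(0, 1)\<close>, then \<open>K_cross D f\<close> is nonnegative: by the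
  layer-cake formula it is enough to treat the indicator of \<open>{t<..}\<close>, for which the integral is the value
  of the continuous version of \<open>f\<close> at the \<open>t\<close>-quantile. Hence, if \<open>\<bar>J s - J r\<bar> \<le> C * (B s - B r)\<close> for \<open>r \<le> s\<close>,
  applying this to \<open>C * B + J\<close> and \<open>C * B - J\<close> gives \<open>\<bar>K_cross J f\<bar> \<le> C * K_cross B f\<close>. For the
  Student scores and \<open>\<nu> \<le> 1\<close>, the derivative \<open>J'\<close> is largest in absolute value at \<open>1 / 2\<close>, which gives the
  best \<open>C\<close> for the Wilcoxon scores; the derivative of the van der Waerden scores is at least \<open>sqrt (2 * pi)\<close>.\<close>

subsection \<open>Weak derivatives of functions on the line\<close>

text \<open>Two obstacles shape the first half. \<open>weak_deriv\<close> is an arbitrary version of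
  the derivative, and \<open>f\<close> agrees only almost everywhere with a continuous function; so
  it has to be shown, from test functions alone, that \<open>f\<close> is almost everywhere a
  primitive \<open>v\<close> of its weak derivative, and that \<open>v\<close> inherits from
  \<open>f\<close> the sign and the limits at infinity. The second obstacle is the zero set of
  \<open>f\<close>: there \<open>loc_score\<close> is 0 by convention, so
  \<open>f * loc_score\<close> forgets whatever the weak derivative does on that set. Only because
  the derivative of a nonnegative primitive vanishes almost everywhere on its zero set do integrals
  of the score become increments of \<open>v\<close>. Scores are compared through their increments,
  so no quantile function is ever differentiated. The constant for the Wilcoxon scores is C =
  J'(1/2), the derivative (\<nu> + 1)/\<nu> of the Student score at 0 divided by the Student density
  at 0; for the van der Waerden scores it is C / sqrt (2 * pi). The final bounds are the squares of
  these constants times the ratio of the \<open>K_score\<close> values, which are 1/12, 1 and (\<nu>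
  + 1)/(\<nu> + 3) for Wilcoxon, van der Waerden and Student.\<close>

definition exp_flat :: "real \<Rightarrow> real poly \<Rightarrow> real \<Rightarrow> real" where
  "exp_flat c p x = (if x > 0 then poly p (inverse x) * exp (- (c * inverse x)) else 0)"

lemma poly_times_exp_tendsto_0:
  fixes c :: real
  assumes "c > 0"
  shows "((\<lambda>y. poly p y * exp (- (c * y))) \<longlongrightarrow> 0) at_top"
proof -
  have lim: "((\<lambda>y. y ^ i * exp (- (c * y))) \<longlongrightarrow> 0) at_top" for i
  proof -
    have "filterlim (\<lambda>y. c * y) at_top at_top"
      using assms by real_asymp
    then have "((\<lambda>y. (c * y) ^ i / exp (c * y)) \<longlongrightarrow> 0) at_top"
      by (rule filterlim_compose[OF tendsto_power_div_exp_0])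
    then have "((\<lambda>y. (c * y) ^ i / exp (c * y) / c ^ i) \<longlongrightarrow> 0 / c ^ i) at_top"
      by (intro tendsto_intros) (use assms in auto)
    moreover have "(\<lambda>y. (c * y) ^ i / exp (c * y) / c ^ i) = (\<lambda>y. y ^ i * exp (- (c * y)))"
      using assms by (auto simp: exp_minus field_simps)
    ultimately show ?thesis by simp
  qed
  have "((\<lambda>y. \<Sum>i\<le>degree p. coeff p i * (y ^ i * exp (- (c * y)))) \<longlongrightarrow> (\<Sum>i\<le>degree p. coeff p i * 0)) at_top"
    by (intro tendsto_intros lim)
  then show ?thesis
    by (simp add: poly_altdef sum_distrib_right mult.assoc)
qed

text \<open>With y = 1/x one has dy/dx = -y^2, so differentiating p(y) exp(-c y) yields the
  polynomial y^2 (c p - p'). Allowing a polynomial factor is what closes the family under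
  differentiation. At 0 the difference quotient from the right is the same expression with y p(y),
  and the exponential beats it.\<close>

lemma exp_flat_has_derivative:
  assumes "c > 0"
  shows "(exp_flat c p has_real_derivative exp_flat c (pCons 0 (pCons 0 (smult c p - pderiv p))) x) (at x)"
proof -
  consider "x > 0" | "x < 0" | "x = 0" by linarith
  then show ?thesis
  proof cases
    case 1
    have "((\<lambda>x. poly p (inverse x) * exp (- (c * inverse x))) has_real_derivative
        exp_flat c (pCons 0 (pCons 0 (smult c p - pderiv p))) x) (at x)"
      using 1 by (auto intro!: derivative_eq_intros simp: exp_flat_def power2_eq_square algebra_simps)
    then show ?thesis
      by (rule has_field_derivative_transform_within_open[where S="{0<..}"]) (use 1 in \<open>auto simp: exp_flat_def\<close>)
  next
    case 2
    have "((\<lambda>x. 0) has_real_derivative exp_flat c (pCons 0 (pCons 0 (smult c p - pderiv p))) x) (at x)"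
      using 2 by (auto simp: exp_flat_def)
    then show ?thesis
      by (rule has_field_derivative_transform_within_open[where S="{..<0}"]) (use 2 in \<open>auto simp: exp_flat_def\<close>)
  next
    case 3
    have "((\<lambda>h. poly (pCons 0 p) (inverse h) * exp (- (c * inverse h))) \<longlongrightarrow> 0) (at_right 0)"
      by (rule filterlim_compose[OF poly_times_exp_tendsto_0[OF assms] filterlim_inverse_at_top_right])
    then have "((\<lambda>h. exp_flat c p h / h) \<longlongrightarrow> 0) (at_right 0)"
      by (rule Lim_transform_eventually)
         (auto simp: eventually_at_filter exp_flat_def field_simps intro!: always_eventually)
    moreover have "((\<lambda>h. exp_flat c p h / h) \<longlongrightarrow> 0) (at_left 0)"
      by (rule Lim_transform_eventually[where f="\<lambda>_. 0"])
         (auto simp: eventually_at_filter exp_flat_def intro!: always_eventually)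
    ultimately show ?thesis
      using 3 by (simp add: has_field_derivative_iff filterlim_at_split exp_flat_def)
  qed
qed

text \<open>Not all smooth functions: only a class that is closed under differentiation and large enough
  to contain the bumps below.\<close>

inductive smooth :: "(real \<Rightarrow> real) \<Rightarrow> bool" where
  smooth_const: "smooth (\<lambda>x. k)"
| smooth_flat: "c > 0 \<Longrightarrow> smooth (\<lambda>x. exp_flat c p (x - a))"
| smooth_flat_reflected: "c > 0 \<Longrightarrow> smooth (\<lambda>x. exp_flat c p (a - x))"
| smooth_add: "smooth f \<Longrightarrow> smooth g \<Longrightarrow> smooth (\<lambda>x. f x + g x)"
| smooth_mult: "smooth f \<Longrightarrow> smooth g \<Longrightarrow> smooth (\<lambda>x. f x * g x)"

lemma smooth_has_derivative:
  "smooth f \<Longrightarrow> \<exists>f'. smooth f' \<and> (\<forall>x. (f has_real_derivative f' x) (at x))"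
proof (induction rule: smooth.induct)
  case (smooth_const k)
  then show ?case by (intro exI[of _ "\<lambda>_. 0"]) (auto intro: smooth.intros)
next
  case (smooth_flat c p a)
  let ?q = "pCons 0 (pCons 0 (smult c p - pderiv p))"
  have "((\<lambda>x. exp_flat c p (x - a)) has_real_derivative exp_flat c ?q (x - a) * 1) (at x)" for x
    by (rule DERIV_chain2[OF exp_flat_has_derivative[OF smooth_flat]]) (auto intro!: derivative_eq_intros)
  then show ?case
    using smooth_flat by (intro exI[of _ "\<lambda>x. exp_flat c ?q (x - a)"]) (auto intro: smooth.intros)
next
  case (smooth_flat_reflected c p a)
  let ?q = "pCons 0 (pCons 0 (smult c p - pderiv p))"
  have "((\<lambda>x. exp_flat c p (a - x)) has_real_derivative exp_flat c ?q (a - x) * (-1)) (at x)" for x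
    by (rule DERIV_chain2[OF exp_flat_has_derivative[OF smooth_flat_reflected]]) (auto intro!: derivative_eq_intros)
  then show ?case
    using smooth_flat_reflected by (intro exI[of _ "\<lambda>x. exp_flat c ?q (a - x) * (-1)"] conjI allI) (rule smooth.intros smooth.smooth_flat_reflected smooth.smooth_const | assumption | simp)+
next
  case (smooth_add f g)
  then obtain f' g' where "smooth f'" "smooth g'"
    "\<And>x. (f has_real_derivative f' x) (at x)" "\<And>x. (g has_real_derivative g' x) (at x)" by blast
  then show ?case
    by (intro exI[of _ "\<lambda>x. f' x + g' x"]) (auto intro!: smooth.intros derivative_eq_intros)
next
  case (smooth_mult f g)
  then obtain f' g' where "smooth f'" "smooth g'"
    "\<And>x. (f has_real_derivative f' x) (at x)" "\<And>x. (g has_real_derivative g' x) (at x)" by blast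
  with smooth_mult show ?case
    by (intro exI[of _ "\<lambda>x. f' x * g x + f x * g' x"]) (auto intro!: smooth.intros derivative_eq_intros)
qed

lemma smooth_deriv_funpow: "smooth f \<Longrightarrow> smooth ((deriv ^^ n) f)"
proof (induction n)
  case (Suc n)
  then obtain f' where "smooth f'" "\<And>x. ((deriv ^^ n) f has_real_derivative f' x) (at x)"
    using smooth_has_derivative by blast
  moreover from this have "deriv ((deriv ^^ n) f) = f'"
    by (intro ext DERIV_imp_deriv)
  ultimately show ?case by simp
qed simp

lemma smooth_continuous: "smooth f \<Longrightarrow> continuous_on S f"
  using smooth_has_derivative[of f] by (metis DERIV_isCont continuous_at_imp_continuous_on)

lemma continuous_imp_locally_integrable: "continuous_on UNIV g \<Longrightarrow> locally_integrable g"
  unfolding locally_integrable_def by (meson borel_integrable_atLeastAtMost' continuous_on_subset subset_UNIV)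

lemma locally_integrableD: "locally_integrable g \<Longrightarrow> set_integrable lborel {a..b} g"
  by (simp add: locally_integrable_def)

lemma locally_integrable_measurable:
  assumes "locally_integrable g"
  shows "g \<in> borel_measurable borel"
proof (rule borel_measurable_LIMSEQ_real)
  show "(\<lambda>n. indicator {-real n..real n} x *\<^sub>R g x) \<longlonglongrightarrow> g x" for x
  proof (rule Lim_transform_eventually[OF tendsto_const])
    obtain N where "\<bar>x\<bar> \<le> real N" using real_arch_simple by blast
    then show "\<forall>\<^sub>F n in sequentially. g x = indicator {-real n..real n} x *\<^sub>R g x"
      by (intro eventually_sequentiallyI[of N]) (auto simp: indicator_def)
  qed
  show "(\<lambda>x. indicator {-real n..real n} x *\<^sub>R g x) \<in> borel_measurable borel" for n
    using locally_integrableD[OF assms, of "-real n" "real n"]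
    by (auto simp: set_integrable_def dest: borel_measurable_integrable)
qed

text \<open>An antiderivative of \<open>B\<close> is constant on each side of the support, and the
  two constants differ by the integral of \<open>B\<close>. Total integral 0 is therefore exactly
  what gives a compactly supported antiderivative; its higher derivatives are those of
  \<open>B\<close>.\<close>

lemma test_function_antiderivative:
  assumes B: "smooth B" and "L < R" and zero: "\<And>x. x \<notin> {L<..<R} \<Longrightarrow> B x = 0"
    and int0: "(LINT x:{L..R}|lborel. B x) = 0"
  obtains \<psi> where "test_function \<psi>" "\<And>x. (\<psi> has_real_derivative B x) (at x)"
    "\<And>x. x \<notin> {L..R} \<Longrightarrow> \<psi> x = 0"
proof -
  have cont: "continuous_on S B" for S by (rule smooth_continuous[OF B])
  have "\<exists>F. \<forall>x. -\<infinity> < ereal x \<longrightarrow> ereal x < \<infinity> \<longrightarrow> (F has_vector_derivative B x) (at x)"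
    by (rule einterval_antiderivative) (use cont[of UNIV] in \<open>auto simp: continuous_on_eq_continuous_at\<close>)
  then obtain F where F: "\<And>x. (F has_real_derivative B x) (at x)"
    by (auto simp: has_real_derivative_iff_has_vector_derivative)
  have contF: "continuous_on S F" for S
    using F by (meson DERIV_isCont continuous_at_imp_continuous_on)
  define \<psi> where "\<psi> x = F x - F L" for x
  have d: "(\<psi> has_real_derivative B x) (at x)" for x
    unfolding \<psi>_def by (auto intro!: derivative_eq_intros F)
  have "(LBINT x=ereal L..ereal R. B x) = F R - F L"
    by (rule interval_integral_FTC_finite)
       (auto intro!: cont F[THEN DERIV_subset] simp: has_real_derivative_iff_has_vector_derivative[symmetric])
  then have eq: "F R = F L"
    using int0 \<open>L < R\<close> by (simp add: interval_integral_Icc)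
  have out: "\<psi> x = 0" if "x \<notin> {L..R}" for x
  proof (cases "x < L")
    case True
    have "F L = F x"
    proof (rule DERIV_isconst_end[OF True contF])
      show "(F has_real_derivative 0) (at y)" if "x < y" "y < L" for y
        using F[of y] zero[of y] that \<open>L < R\<close> by simp
    qed
    then show ?thesis by (simp add: \<psi>_def)
  next
    case False
    then have "R < x" using that by auto
    have "F x = F R"
    proof (rule DERIV_isconst_end[OF \<open>R < x\<close> contF])
      show "(F has_real_derivative 0) (at y)" if "R < y" "y < x" for y
        using F[of y] zero[of y] that \<open>L < R\<close> by simp
    qed
    then show ?thesis by (simp add: \<psi>_def eq)
  qed
  have "test_function \<psi>"
    unfolding test_function_def
  proof (intro conjI allI exI impI)
    show "(deriv ^^ n) \<psi> differentiable at x" for n x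
    proof (cases n)
      case 0
      then show ?thesis using d by (auto simp: real_differentiable_def)
    next
      case (Suc m)
      have "deriv \<psi> = B" by (intro ext DERIV_imp_deriv d)
      then have "(deriv ^^ n) \<psi> = (deriv ^^ m) B"
        by (simp add: Suc funpow_Suc_right del: funpow.simps)
      then show ?thesis
        using smooth_has_derivative[OF smooth_deriv_funpow[OF B, of m]] by (auto simp: real_differentiable_def)
    qed
    show "\<psi> x = 0" if "\<bar>x\<bar> > max \<bar>L\<bar> \<bar>R\<bar>" for x
      by (rule out) (use that in auto)
  qed
  with d out that show thesis by blast
qed

text \<open>The rate 1/(n + 1) tends to 0, so on the open interval both exponentials tend to 1:
  smooth functions bounded by 1 that converge pointwise to an indicator.\<close>

definition bump :: "real \<Rightarrow> real \<Rightarrow> nat \<Rightarrow> real \<Rightarrow> real" where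
  "bump a b n x = exp_flat (1 / real (Suc n)) 1 (x - a) * exp_flat (1 / real (Suc n)) 1 (b - x)"

lemma smooth_bump: "smooth (bump a b n)"
  unfolding bump_def by (intro smooth.intros) auto

lemma bump_eq_0: "x \<notin> {a<..<b} \<Longrightarrow> bump a b n x = 0"
  by (auto simp: bump_def exp_flat_def)

lemma abs_bump_le: "\<bar>bump a b n x\<bar> \<le> indicator {a..b} x"
  by (auto simp: bump_def exp_flat_def abs_mult indicator_def intro!: mult_le_one)

lemma bump_tendsto: "(\<lambda>n. bump a b n x) \<longlonglongrightarrow> indicator {a<..<b} x"
proof (cases "x \<in> {a<..<b}")
  case True
  have "(\<lambda>n. exp (- (1 / real (Suc n) * inverse (x - a))) * exp (- (1 / real (Suc n) * inverse (b - x))))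
      \<longlonglongrightarrow> exp (- (0 * inverse (x - a))) * exp (- (0 * inverse (b - x)))"
    by (intro tendsto_intros LIMSEQ_Suc[OF lim_1_over_n])
  with True show ?thesis by (simp add: bump_def exp_flat_def)
qed (simp add: bump_eq_0)

lemma integral_bump_tendsto:
  assumes "locally_integrable h"
  shows "integrable lborel (\<lambda>x. h x * bump a b n x)"
    "(\<lambda>n. LINT x|lborel. h x * bump a b n x) \<longlonglongrightarrow> (LINT x:{a..b}|lborel. h x)"
proof -
  note [measurable] = locally_integrable_measurable[OF assms]
  have [measurable]: "bump a b n \<in> borel_measurable borel" for n
    by (intro borel_measurable_continuous_onI smooth_continuous smooth_bump)
  have dom: "integrable lborel (\<lambda>x. indicator {a..b} x * \<bar>h x\<bar>)"
    using set_integrable_abs[OF locally_integrableD[OF assms, of a b]] by (simp add: set_integrable_def)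
  have bnd: "\<bar>h x * bump a b n x\<bar> \<le> indicator {a..b} x * \<bar>h x\<bar>" for x n
    using mult_left_mono[OF abs_bump_le[of a b n x], of "\<bar>h x\<bar>"] by (simp add: abs_mult mult.commute)
  show "integrable lborel (\<lambda>x. h x * bump a b n x)"
    by (rule Bochner_Integration.integrable_bound[OF dom _ AE_I2], measurable) (use bnd[of _ n] in \<open>simp add: abs_mult\<close>)
  have "(\<lambda>n. LINT x|lborel. h x * bump a b n x) \<longlonglongrightarrow> (LINT x|lborel. h x * indicator {a<..<b} x)"
    by (rule integral_dominated_convergence[OF _ _ dom], measurable)
       (intro AE_I2 tendsto_intros bump_tendsto, use bnd in \<open>simp\<close>)
  also have "(LINT x|lborel. h x * indicator {a<..<b} x) = (LINT x:{a..b}|lborel. h x)"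
    unfolding set_lebesgue_integral_def
    by (rule integral_cong_AE) (use AE_lborel_singleton[of a] AE_lborel_singleton[of b] in \<open>auto simp: indicator_def\<close>)
  finally show "(\<lambda>n. LINT x|lborel. h x * bump a b n x) \<longlonglongrightarrow> (LINT x:{a..b}|lborel. h x)" .
qed

text \<open>Closed intervals are stable under intersection and generate the Borel sets, so a Dynkin
  induction carries vanishing integrals to all Borel sets. Complements require a finite total
  integral, hence the truncation to [-n, n].\<close>

lemma AE_zero_if_interval_integrals_zero:
  fixes h :: "real \<Rightarrow> real"
  assumes "locally_integrable h" and zero: "\<And>a b. a < b \<Longrightarrow> (LINT x:{a..b}|lborel. h x) = 0"
  shows "AE x in lborel. h x = 0"
proof -
  note [measurable] = locally_integrable_measurable[OF assms(1)]
  \<comment> \<open>Intersecting with [-n, n] can produce empty or one-point intervals.\<close>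
  have zero': "(LINT x:{a..b}|lborel. h x) = 0" for a b
  proof (cases "a < b")
    case False
    have "AE x in lborel. x \<noteq> a" by (rule AE_lborel_singleton)
    then have "AE x in lborel. indicator {a..b} x *\<^sub>R h x = 0"
      by eventually_elim (use False in \<open>auto simp: indicator_def\<close>)
    then show ?thesis
      unfolding set_lebesgue_integral_def by (rule integral_eq_zero_AE)
  qed (rule zero)
  have "AE x in lborel. \<forall>n. indicator {-real n..real n} x * h x = 0"
  proof (subst AE_all_countable, rule allI, rule sigma_finite_measure.density_zero[OF sigma_finite_lborel])
    fix n
    let ?h = "\<lambda>x. indicator {-real n..real n} x * h x"
    show int: "integrable lborel ?h"
      using locally_integrableD[OF assms(1)] by (simp add: set_integrable_def)
    have sint: "set_integrable lborel A ?h" if "A \<in> sets borel" for A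
      by (rule set_integrable_subset[where A=UNIV]) (use int that in \<open>auto simp: set_integrable_def\<close>)
    have all: "(LINT x:UNIV|lborel. ?h x) = 0"
      using zero'[of "-real n" "real n"] by (simp add: set_lebesgue_integral_def)
    fix A :: "real set" assume "A \<in> sets lborel"
    then have A: "A \<in> sigma_sets UNIV (range (\<lambda>(a, b). {a..b}))"
      by (simp add: borel_eq_atLeastAtMost)
    have "Int_stable (range (\<lambda>(a, b). {a..b::real}))"
      by (auto simp: Int_stable_def)
    moreover have "range (\<lambda>(a, b). {a..b::real}) \<subseteq> Pow UNIV" by simp
    ultimately show "(LINT x:A|lborel. ?h x) = 0"
      using A
    proof (induction rule: sigma_sets_induct_disjoint)
      case (basic A)
      then obtain a b where A: "A = {a..b}" by auto
      have "(LINT x:A|lborel. ?h x) = (LINT x:{max a (-real n)..min b (real n)}|lborel. h x)"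
        unfolding set_lebesgue_integral_def
        by (rule Bochner_Integration.integral_cong) (auto simp: A indicator_def)
      then show ?case using zero' by simp
    next
      case empty show ?case by (simp add: set_lebesgue_integral_def)
    next
      case (compl A)
      then have "A \<in> sets borel" by (simp add: borel_eq_atLeastAtMost)
      have "(LINT x:UNIV|lborel. ?h x) = (LINT x:(A \<union> (UNIV - A))|lborel. ?h x)" by simp
      also have "\<dots> = (LINT x:A|lborel. ?h x) + (LINT x:(UNIV - A)|lborel. ?h x)"
        by (rule set_integral_Un) (use \<open>A \<in> sets borel\<close> in \<open>auto intro!: sint\<close>)
      finally show ?case using compl all by simp
    next
      case (union A)
      then have "A i \<in> sets borel" for i by (auto simp: borel_eq_atLeastAtMost)
      then have "(LINT x:(\<Union>i. A i)|lborel. ?h x) = (\<Sum>i. LINT x:A i|lborel. ?h x)"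
        using union by (intro lebesgue_integral_countable_add) (auto simp: disjoint_family_on_def intro!: sint)
      then show ?case using union by simp
    qed
  qed
  then show ?thesis
  proof eventually_elim
    case (elim x)
    obtain N where "\<bar>x\<bar> \<le> real N" using real_arch_simple by blast
    with spec[OF elim, of N] show ?case by (auto simp: indicator_def)
  qed
qed

text \<open>For two intervals, the combination of bumps with total integral 0 is the derivative of a test function.
  Letting the bumps tend to the indicators shows that the averages of \<open>h\<close> over any two intervals agree.\<close>

lemma weak_derivative_zero_imp_AE_const:
  fixes h :: "real \<Rightarrow> real"
  assumes h: "locally_integrable h"
    and weak: "\<And>\<psi>. test_function \<psi> \<Longrightarrow> (LINT x|lborel. h x * deriv \<psi> x) = 0"
  shows "\<exists>k. AE x in lborel. h x = k"
proof -
  have one: "locally_integrable (\<lambda>_. 1)" by (intro continuous_imp_locally_integrable continuous_intros)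
  have proportional: "(d - c) * (LINT x:{a..b}|lborel. h x) = (b - a) * (LINT x:{c..d}|lborel. h x)" 
    if "a < b" "c < d" for a b c d
  proof -
    define I where "I a b n = (LINT x|lborel. bump a b n x)" for a b n
    have I: "I a b \<longlonglongrightarrow> b - a" if "a < b" for a b
      using integral_bump_tendsto(2)[OF one, of a b] that by (simp add: I_def[abs_def] set_lebesgue_integral_def)
    have int1: "integrable lborel (\<lambda>x. bump a b n x)" for a b n
      using integral_bump_tendsto(1)[OF one, of a b] by simp
    have eq: "I c d n * (LINT x|lborel. h x * bump a b n x) = I a b n * (LINT x|lborel. h x * bump c d n x)" for n
    proof -
      \<comment> \<open>The coefficients are the exact integrals of the bumps, so that the total is
        0 for each n; the lengths d - c and b - a appear only in the limit.\<close>
      define B where "B x = I c d n * bump a b n x + (- I a b n) * bump c d n x" for x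
      have B: "smooth B" unfolding B_def by (intro smooth.intros smooth_bump)
      let ?L = "min a c" and ?R = "max b d"
      have z: "B x = 0" if "x \<notin> {?L<..<?R}" for x
      proof -
        have "x \<notin> {a<..<b}" "x \<notin> {c<..<d}" using that by auto
        then show ?thesis by (simp add: B_def bump_eq_0)
      qed
      have "(LINT x:{?L..?R}|lborel. B x) = (LINT x|lborel. B x)"
        unfolding set_lebesgue_integral_def
      proof (rule Bochner_Integration.integral_cong[OF refl])
        show "indicator {?L..?R} x *\<^sub>R B x = B x" for x
          by (cases "x \<in> {?L<..<?R}") (simp, simp add: z del: greaterThanLessThan_iff)
      qed
      also have "\<dots> = 0"
        unfolding B_def by (subst Bochner_Integration.integral_add) (auto simp: I_def int1)
      finally have int0: "(LINT x:{?L..?R}|lborel. B x) = 0" .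
      have "?L < ?R" using that by linarith
      obtain \<psi> where \<psi>: "test_function \<psi>" "\<And>x. (\<psi> has_real_derivative B x) (at x)"
        by (rule test_function_antiderivative[OF B \<open>?L < ?R\<close> z int0]) (assumption, rule that)
      have "deriv \<psi> = B" by (intro ext DERIV_imp_deriv \<psi>)
      then have "0 = (LINT x|lborel. h x * B x)"
        using weak[OF \<psi>(1)] by simp
      also have "\<dots> = (LINT x|lborel. I c d n * (h x * bump a b n x) + (- I a b n) * (h x * bump c d n x))"
        by (simp add: B_def algebra_simps)
      also have "\<dots> = I c d n * (LINT x|lborel. h x * bump a b n x) - I a b n * (LINT x|lborel. h x * bump c d n x)"
        using integral_bump_tendsto(1)[OF h] by (subst Bochner_Integration.integral_add) auto
      finally show ?thesis by simp
    qed
    have "(\<lambda>n. I c d n * (LINT x|lborel. h x * bump a b n x)) \<longlonglongrightarrow> (d - c) * (LINT x:{a..b}|lborel. h x)"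
      by (intro tendsto_mult I that integral_bump_tendsto h)
    moreover have "(\<lambda>n. I a b n * (LINT x|lborel. h x * bump c d n x)) \<longlonglongrightarrow> (b - a) * (LINT x:{c..d}|lborel. h x)"
      by (intro tendsto_mult I that integral_bump_tendsto h)
    ultimately show ?thesis
      using LIMSEQ_unique by (simp add: eq)
  qed
  define k where "k = (LINT x:{0..1}|lborel. h x)"
  have const: "locally_integrable (\<lambda>_. k)" by (intro continuous_imp_locally_integrable continuous_intros)
  have "AE x in lborel. h x - k = 0"
  proof (rule AE_zero_if_interval_integrals_zero)
    show "locally_integrable (\<lambda>x. h x - k)"
      using h const by (auto simp: locally_integrable_def intro!: set_integral_diff)
    fix a b :: real assume "a < b"
    then have "(LINT x:{a..b}|lborel. h x) = (b - a) * k"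
      using proportional[of a b 0 1] by (simp add: k_def)
    moreover have "(LINT x:{a..b}|lborel. k) = (b - a) * k"
      using \<open>a < b\<close> by (simp add: set_lebesgue_integral_def)
    moreover have "(LINT x:{a..b}|lborel. h x - k) = (LINT x:{a..b}|lborel. h x) - (LINT x:{a..b}|lborel. k)"
      by (intro set_integral_diff locally_integrableD h const)
    ultimately show "(LINT x:{a..b}|lborel. h x - k) = 0" by simp
  qed
  then show ?thesis by auto
qed

subsection \<open>Primitives of locally integrable functions\<close>

lemma locally_integrable_interval:
  fixes a b :: real
  assumes "locally_integrable g"
  shows "interval_lebesgue_integrable lborel a b g"
proof -
  have "set_integrable lborel (einterval (ereal x) (ereal y)) g" for x y
    by (rule set_integrable_subset[OF locally_integrableD[OF assms, of x y]]) (auto simp: einterval_iff)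
  then show ?thesis by (auto simp: interval_lebesgue_integrable_def)
qed

lemma interval_integral_combine:
  fixes a b c :: real
  assumes "locally_integrable g"
  shows "(LBINT t=ereal a..ereal b. g t) + (LBINT t=ereal b..ereal c. g t) = (LBINT t=ereal a..ereal c. g t)"
  by (rule interval_integral_sum) (simp add: locally_integrable_interval[OF assms] flip: ereal_min ereal_max)

lemma locally_integrable_continuous_mult:
  assumes h: "continuous_on UNIV h" and g: "locally_integrable g"
  shows "locally_integrable (\<lambda>x. h x * g x)"
  unfolding locally_integrable_def
proof (intro allI)
  fix a b :: real
  note [measurable] = locally_integrable_measurable[OF g] borel_measurable_continuous_onI[OF h]
  have "bounded (h ` {a..b})"
    by (intro compact_imp_bounded compact_continuous_image continuous_on_subset[OF h]) auto
  then obtain B where "\<forall>y\<in>h ` {a..b}. norm y \<le> B"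
    unfolding bounded_iff by blast
  then have B: "\<bar>h x\<bar> \<le> B" if "x \<in> {a..b}" for x
    using that by auto
  show "set_integrable lborel {a..b} (\<lambda>x. h x * g x)"
  proof (rule set_integrable_bound)
    show "set_integrable lborel {a..b} (\<lambda>x. B * g x)"
      using locally_integrableD[OF g] by auto
    show "AE x in lborel. x \<in> {a..b} \<longrightarrow> norm (h x * g x) \<le> norm (B * g x)"
      using B by (auto simp: abs_mult intro!: AE_I2 mult_right_mono order_trans[OF B abs_ge_self])
  qed (simp add: set_borel_measurable_def)
qed

lemma locally_integrable_add:
  "locally_integrable f \<Longrightarrow> locally_integrable g \<Longrightarrow> locally_integrable (\<lambda>x. f x + g x)"
  and locally_integrable_diff:
  "locally_integrable f \<Longrightarrow> locally_integrable g \<Longrightarrow> locally_integrable (\<lambda>x. f x - g x)"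
  and locally_integrable_abs:
  "locally_integrable f \<Longrightarrow> locally_integrable (\<lambda>x. \<bar>f x\<bar>)"
  by (auto simp: locally_integrable_def intro: set_integrable_abs)

lemma continuous_on_primitive:
  fixes c :: real
  assumes g: "locally_integrable g"
  shows "continuous_on UNIV (\<lambda>x. LBINT t=ereal c..ereal x. g t)"
proof -
  have "isCont (\<lambda>x. LBINT t=ereal c..ereal x. g t) x" for x
  proof -
    \<comment> \<open>Moving the base point to x - 1 makes the integral near x one over an interval
      to the right of its base point; the rest is a constant.\<close>
    have "continuous_on {x - 1..x + 1} (\<lambda>y. integral {x - 1..y} g)"
      by (intro indefinite_integral_continuous_1 set_borel_integral_eq_integral locally_integrableD g)
    then have "continuous_on {x - 1..x + 1} (\<lambda>y. (LBINT t=ereal c..ereal (x - 1). g t) + integral {x - 1..y} g)"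
      by (intro continuous_intros)
    then have "continuous_on {x - 1..x + 1} (\<lambda>y. LBINT t=ereal c..ereal y. g t)"
    proof (rule continuous_on_eq)
      fix y assume "y \<in> {x - 1..x + 1}"
      then have "(LBINT t=ereal (x - 1)..ereal y. g t) = integral {x - 1..y} g"
        by (intro interval_integral_eq_integral locally_integrableD g) auto
      then show "(LBINT t=ereal c..ereal (x - 1). g t) + integral {x - 1..y} g = (LBINT t=ereal c..ereal y. g t)"
        using interval_integral_combine[OF g, of c "x - 1" y] by simp
    qed
    then show ?thesis by (rule continuous_on_interior) auto
  qed
  then show ?thesis by (simp add: continuous_on_eq_continuous_at)
qed

section \<open>Chain rule and integration by parts for primitives\<close>

lemma eq_if_increments_dominated:
  fixes E M :: "real \<Rightarrow> real"
  assumes "a \<le> b"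
    and loc: "\<And>e. e > 0 \<Longrightarrow> \<exists>d>0. \<forall>x y. a \<le> x \<longrightarrow> x \<le> y \<longrightarrow> y \<le> b \<longrightarrow> y - x < d \<longrightarrow>
        \<bar>E y - E x\<bar> \<le> e * (M y - M x)"
  shows "E b = E a"
proof (rule ccontr)
  assume ne: "E b \<noteq> E a"
  have glob: "\<bar>E b - E a\<bar> \<le> e * (M b - M a)" if e: "e > 0" for e
  proof -
    from loc[OF e] obtain d where "d > 0" and
      d: "\<And>x y. a \<le> x \<Longrightarrow> x \<le> y \<Longrightarrow> y \<le> b \<Longrightarrow> y - x < d \<Longrightarrow> \<bar>E y - E x\<bar> \<le> e * (M y - M x)"
      by blast
    obtain n :: nat where n: "real n * d > b - a" using \<open>d > 0\<close> reals_Archimedean3 by blast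
    then have "n > 0" using \<open>a \<le> b\<close> by (cases n) auto
    define p where "p i = a + real i * ((b - a) / n)" for i
    have p0: "p 0 = a" and pn: "p n = b" using \<open>n > 0\<close> by (auto simp: p_def)
    have step: "(b - a) / n < d" "0 \<le> (b - a) / n"
      using n \<open>n > 0\<close> \<open>a \<le> b\<close> by (auto simp: field_simps)
    have pa: "a \<le> p i" for i unfolding p_def using step(2) by (simp del: times_divide_eq_right)
    have pS: "p (Suc i) = p i + (b - a) / n" for i by (simp add: p_def add_divide_distrib diff_divide_distrib ring_distribs)
    have pb: "p i \<le> b" if "i \<le> n" for i
    proof -
      have "real i * ((b - a) / n) \<le> real n * ((b - a) / n)"
        by (intro mult_right_mono step) (use that in auto)
      then show ?thesis using pn by (simp add: p_def)
    qed
    have "i \<le> n \<Longrightarrow> \<bar>E (p i) - E a\<bar> \<le> e * (M (p i) - M a)" for i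
    proof (induction i)
      case (Suc i)
      then have "\<bar>E (p (Suc i)) - E (p i)\<bar> \<le> e * (M (p (Suc i)) - M (p i))"
        by (intro d pa pb) (use step pS in auto)
      with Suc show ?case by (simp add: algebra_simps)
    qed (simp add: p0)
    from this[of n] show ?thesis by (simp add: pn)
  qed
  define x where "x = \<bar>E b - E a\<bar>"
  define m where "m = M b - M a"
  have "x > 0" using ne by (simp add: x_def)
  \<comment> \<open>This choice of e forces x \<le> x / 2; adding 1 covers m = 0.\<close>
  have "x / (2 * (\<bar>m\<bar> + 1)) > 0" using \<open>x > 0\<close> by (intro divide_pos_pos) auto
  from glob[OF this] have "x \<le> x / (2 * (\<bar>m\<bar> + 1)) * m"
    unfolding x_def m_def .
  also have "\<dots> \<le> x / (2 * (\<bar>m\<bar> + 1)) * (\<bar>m\<bar> + 1)"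
    by (intro mult_left_mono) (use \<open>x > 0\<close> in auto)
  also have "\<dots> = x / 2" by (simp add: divide_simps)
  finally show False using \<open>x > 0\<close> by simp
qed

text \<open>On a short interval the mean value theorem turns the increment of
  \<open>\<eta> (u x)\<close> into \<open>\<eta>' \<xi>\<close> times the integral of
  \<open>g\<close>. Replacing \<open>\<xi>\<close> by \<open>u t\<close> costs at most e times the
  integral of |g|, by the Lipschitz bound and uniform continuity of \<open>u\<close>. That is the
  domination required above, with \<open>M\<close> a primitive of |g|. The set \<open>S\<close> must
  be an interval to contain \<open>\<xi>\<close>; it will be the whole line for squares and a
  half-line for a logarithm.\<close>

lemma chain_rule_primitive:
  fixes k c a b :: real and g \<eta> \<eta>' :: "real \<Rightarrow> real" and S :: "real set"
  defines "u \<equiv> \<lambda>x. k + (LBINT t=ereal c..ereal x. g t)"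
  assumes g: "locally_integrable g" and S: "is_interval S" "\<And>x. u x \<in> S"
    and deriv: "\<And>s. s \<in> S \<Longrightarrow> (\<eta> has_real_derivative \<eta>' s) (at s)"
    and lip: "\<And>s t. s \<in> S \<Longrightarrow> t \<in> S \<Longrightarrow> \<bar>\<eta>' s - \<eta>' t\<bar> \<le> L * \<bar>s - t\<bar>" and "L > 0"
    and "a \<le> b"
  shows "locally_integrable (\<lambda>t. \<eta>' (u t) * g t)"
    and "\<eta> (u b) - \<eta> (u a) = (LBINT t=ereal a..ereal b. \<eta>' (u t) * g t)"
proof -
  have cu: "continuous_on UNIV u"
    unfolding u_def by (intro continuous_intros continuous_on_primitive g)
  have "continuous_on S \<eta>'"
    by (rule lipschitz_on_continuous_on[of L], rule lipschitz_onI) (use lip \<open>L > 0\<close> in \<open>auto simp: dist_real_def\<close>)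
  then have c\<eta>: "continuous_on UNIV (\<lambda>t. \<eta>' (u t))"
    by (rule continuous_on_compose2[OF _ cu]) (use S in auto)
  show loc: "locally_integrable (\<lambda>t. \<eta>' (u t) * g t)"
    by (rule locally_integrable_continuous_mult[OF c\<eta> g])
  let ?w = "\<lambda>t. \<eta>' (u t) * g t"
  define E where "E x = \<eta> (u x) - (LBINT t=ereal c..ereal x. ?w t)" for x
  define M where "M x = (LBINT t=ereal c..ereal x. \<bar>g t\<bar>)" for x
  note gabs = locally_integrable_abs[OF g]
  have "E b = E a"
  proof (rule eq_if_increments_dominated[OF \<open>a \<le> b\<close>])
    fix e :: real assume "e > 0"
    have "uniformly_continuous_on {a..b} u"
      by (intro compact_uniformly_continuous continuous_on_subset[OF cu]) auto
    then obtain d where "d > 0" and d: "\<And>x y. x \<in> {a..b} \<Longrightarrow> y \<in> {a..b} \<Longrightarrow> \<bar>y - x\<bar> < d \<Longrightarrow> \<bar>u y - u x\<bar> < e / L"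
      using \<open>e > 0\<close> \<open>L > 0\<close> unfolding uniformly_continuous_on_def dist_real_def by (metis divide_pos_pos)
    have "\<bar>E y - E x\<bar> \<le> e * (M y - M x)" if xy: "a \<le> x" "x \<le> y" "y \<le> b" "y - x < d" for x y
    proof -
      obtain \<xi> where \<xi>: "min (u x) (u y) \<le> \<xi>" "\<xi> \<le> max (u x) (u y)" 
        and mv: "\<eta> (u y) - \<eta> (u x) = \<eta>' \<xi> * (u y - u x)"
      proof -
        have inS: "s \<in> S" if "min (u x) (u y) \<le> s" "s \<le> max (u x) (u y)" for s
          using S that by (auto simp: min_def max_def is_interval_1 split: if_splits)
        consider "u x = u y" | "u x < u y" | "u y < u x" by linarith
        then show thesis
        proof cases
          case 1 then show thesis by (intro that[of "u x"]) auto
        next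
          case 2
          obtain z where "u x < z" "z < u y" "\<eta> (u y) - \<eta> (u x) = (u y - u x) * \<eta>' z"
            using MVT2[OF 2, of \<eta> \<eta>'] deriv inS 2 by auto
          then show thesis by (intro that[of z]) auto
        next
          case 3
          obtain z where "u y < z" "z < u x" "\<eta> (u x) - \<eta> (u y) = (u x - u y) * \<eta>' z"
            using MVT2[OF 3, of \<eta> \<eta>'] deriv inS 3 by auto
          then show thesis by (intro that[of z]) (auto simp: algebra_simps)
        qed
      qed
      have \<xi>S: "\<xi> \<in> S"
        using S \<xi> by (auto simp: min_def max_def is_interval_1 split: if_splits)
      have "u y - u x = (LBINT t=ereal x..ereal y. g t)"
        using interval_integral_combine[OF g, of c x y] by (simp add: u_def)
      then have ux: "u y - u x = (LINT t:{x..y}|lborel. g t)"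
        using xy by (simp add: interval_integral_Icc)
      have wx: "(LBINT t=ereal c..ereal y. ?w t) - (LBINT t=ereal c..ereal x. ?w t) = (LINT t:{x..y}|lborel. ?w t)"
        using interval_integral_combine[OF loc, of c x y] xy by (simp add: interval_integral_Icc)
      have Mx: "M y - M x = (LINT t:{x..y}|lborel. \<bar>g t\<bar>)"
        using interval_integral_combine[OF gabs, of c x y] xy by (simp add: interval_integral_Icc M_def)
      have diff_int: "set_integrable lborel {x..y} (\<lambda>t. \<eta>' \<xi> * g t - ?w t)"
        by (intro set_integral_diff set_integrable_mult_right locally_integrableD g loc)
      have "E y - E x = (LINT t:{x..y}|lborel. \<eta>' \<xi> * g t - ?w t)"
        using mv wx ux by (subst set_integral_diff(2))
          (auto simp: E_def intro!: set_integrable_mult_right locally_integrableD[OF g] locally_integrableD[OF loc])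
      then have "\<bar>E y - E x\<bar> \<le> (LINT t:{x..y}|lborel. \<bar>\<eta>' \<xi> * g t - ?w t\<bar>)"
        using set_integral_norm_bound[OF diff_int] by simp
      also have "\<dots> \<le> (LINT t:{x..y}|lborel. e * \<bar>g t\<bar>)"
      proof (rule set_integral_mono)
        fix t assume t: "t \<in> {x..y}"
        then have "\<bar>u x - u t\<bar> < e / L" "\<bar>u y - u t\<bar> < e / L"
          using xy by (intro d; force)+
        then have "\<bar>\<xi> - u t\<bar> \<le> e / L" using \<xi> by linarith
        then have "L * \<bar>\<xi> - u t\<bar> \<le> e" using \<open>L > 0\<close> by (simp add: field_simps)
        then have "\<bar>\<eta>' \<xi> - \<eta>' (u t)\<bar> \<le> e" using lip[OF \<xi>S S(2), of t] by linarith
        then show "\<bar>\<eta>' \<xi> * g t - ?w t\<bar> \<le> e * \<bar>g t\<bar>"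
          by (simp add: abs_mult mult_right_mono flip: left_diff_distrib)
      qed (intro set_integrable_abs diff_int set_integrable_mult_right locally_integrableD gabs)+
      finally show ?thesis by (simp add: Mx)
    qed
    with \<open>d > 0\<close> show "\<exists>d>0. \<forall>x y. a \<le> x \<longrightarrow> x \<le> y \<longrightarrow> y \<le> b \<longrightarrow> y - x < d \<longrightarrow> \<bar>E y - E x\<bar> \<le> e * (M y - M x)"
      by blast
  qed
  then show "\<eta> (u b) - \<eta> (u a) = (LBINT t=ereal a..ereal b. ?w t)"
    using interval_integral_combine[OF loc, of c a b] by (simp add: E_def)
qed

text \<open>Polarization: the chain rule for squares, applied to \<open>u + \<psi>\<close> and \<open>u - \<psi>\<close>.\<close>

lemma integration_by_parts_primitive:
  fixes k c a b :: real and g \<psi> \<psi>' :: "real \<Rightarrow> real"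
  defines "u \<equiv> \<lambda>x. k + (LBINT t=ereal c..ereal x. g t)"
  assumes g: "locally_integrable g" and \<psi>: "\<And>x. (\<psi> has_real_derivative \<psi>' x) (at x)"
    and cont: "continuous_on UNIV \<psi>'" and "a \<le> b"
  shows "(LBINT t=ereal a..ereal b. g t * \<psi> t) + (LBINT t=ereal a..ereal b. u t * \<psi>' t) = u b * \<psi> b - u a * \<psi> a"
proof -
  have \<psi>'L: "locally_integrable \<psi>'" by (rule continuous_imp_locally_integrable[OF cont])
  \<comment> \<open>Writing \<open>\<psi>\<close> as a primitive with the base point of
    \<open>u\<close> puts u + \<psi> and u - \<psi> into the form required by the chain
    rule.\<close>
  have \<psi>_eq: "\<psi> x = \<psi> c + (LBINT t=ereal c..ereal x. \<psi>' t)" for x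
  proof -
    have "(LBINT t=ereal c..ereal x. \<psi>' t) = \<psi> x - \<psi> c"
      by (rule interval_integral_FTC_finite)
         (auto intro!: continuous_on_subset[OF cont] has_field_derivative_at_within \<psi>
               simp: has_real_derivative_iff_has_vector_derivative[symmetric])
    then show ?thesis by simp
  qed
  have cu: "continuous_on UNIV u"
    unfolding u_def by (intro continuous_intros continuous_on_primitive g)
  have c\<psi>: "continuous_on UNIV \<psi>"
    using \<psi> by (meson DERIV_isCont continuous_at_imp_continuous_on)
  have lip: "\<bar>2 * s - 2 * t\<bar> \<le> 2 * \<bar>s - t\<bar>" for s t :: real by (simp add: abs_if)
  have plus: "u x + \<psi> x = (k + \<psi> c) + (LBINT t=ereal c..ereal x. g t + \<psi>' t)" for x
    by (subst interval_lebesgue_integral_add)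
       (auto simp: u_def \<psi>_eq[of x] intro!: locally_integrable_interval g \<psi>'L)
  have minus: "u x - \<psi> x = (k - \<psi> c) + (LBINT t=ereal c..ereal x. g t - \<psi>' t)" for x
    by (subst interval_lebesgue_integral_diff)
       (auto simp: u_def \<psi>_eq[of x] intro!: locally_integrable_interval g \<psi>'L)
  have int_plus: "locally_integrable (\<lambda>t. 2 * (u t + \<psi> t) * (g t + \<psi>' t))"
    and int_minus: "locally_integrable (\<lambda>t. 2 * (u t - \<psi> t) * (g t - \<psi>' t))"
    by (intro locally_integrable_continuous_mult continuous_intros cu c\<psi>
        locally_integrable_add locally_integrable_diff g \<psi>'L)+
  have "(u b + \<psi> b)\<^sup>2 - (u a + \<psi> a)\<^sup>2 = (LBINT t=ereal a..ereal b. 2 * (u t + \<psi> t) * (g t + \<psi>' t))"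
    unfolding plus
    by (rule chain_rule_primitive(2)[where \<eta>="\<lambda>s. s\<^sup>2" and \<eta>'="\<lambda>s. 2 * s" and S=UNIV and L=2])
       (auto intro!: locally_integrable_add g \<psi>'L derivative_eq_intros lip simp: \<open>a \<le> b\<close>)
  moreover have "(u b - \<psi> b)\<^sup>2 - (u a - \<psi> a)\<^sup>2 = (LBINT t=ereal a..ereal b. 2 * (u t - \<psi> t) * (g t - \<psi>' t))"
    unfolding minus
    by (rule chain_rule_primitive(2)[where \<eta>="\<lambda>s. s\<^sup>2" and \<eta>'="\<lambda>s. 2 * s" and S=UNIV and L=2])
       (auto intro!: locally_integrable_diff g \<psi>'L derivative_eq_intros lip simp: \<open>a \<le> b\<close>)
  moreover have "(LBINT t=ereal a..ereal b. 2 * (u t + \<psi> t) * (g t + \<psi>' t)) - (LBINT t=ereal a..ereal b. 2 * (u t - \<psi> t) * (g t - \<psi>' t))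
      = (LBINT t=ereal a..ereal b. 4 * (g t * \<psi> t + u t * \<psi>' t))"
    using locally_integrable_interval[OF int_plus] locally_integrable_interval[OF int_minus]
    by (subst interval_lebesgue_integral_diff(2)[symmetric]) (auto simp: algebra_simps)
  moreover have "(LBINT t=ereal a..ereal b. 4 * (g t * \<psi> t + u t * \<psi>' t)) = 4 * ((LBINT t=ereal a..ereal b. g t * \<psi> t) + (LBINT t=ereal a..ereal b. u t * \<psi>' t))"
    using locally_integrable_interval[OF locally_integrable_continuous_mult[OF c\<psi> g]]
      locally_integrable_interval[OF locally_integrable_continuous_mult[OF cu \<psi>'L]]
    by (subst interval_lebesgue_integral_mult_right, subst interval_lebesgue_integral_add(2)) (auto simp: mult.commute)
  ultimately show ?thesis by (simp add: power2_eq_square algebra_simps)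
qed

lemma integral_compact_support:
  fixes f :: "real \<Rightarrow> real" and R :: real
  assumes f: "locally_integrable f" and z: "\<And>x. \<bar>x\<bar> > R \<Longrightarrow> f x = 0" and "R \<ge> 0"
  shows "integrable lborel f" "(LINT x|lborel. f x) = (LBINT x=ereal (-R)..ereal R. f x)"
proof -
  have *: "(\<lambda>x. indicator {-R..R} x *\<^sub>R f x) = f"
  proof
    fix x show "indicator {-R..R} x *\<^sub>R f x = f x"
      using z[of x] by (cases "\<bar>x\<bar> > R") (auto simp: indicator_def)
  qed
  show "integrable lborel f"
    using locally_integrableD[OF f, of "-R" R] by (simp only: set_integrable_def *)
  show "(LINT x|lborel. f x) = (LBINT x=ereal (-R)..ereal R. f x)"
    by (subst interval_integral_Icc) (use \<open>R \<ge> 0\<close> in simp, simp only: set_lebesgue_integral_def *)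
qed

text \<open>Integration by parts shows that the primitive \<open>u\<close> of \<open>g\<close> has
  the weak derivative \<open>g\<close> too, so \<open>f - u\<close> has weak derivative 0 and is
  almost everywhere constant.\<close>

lemma has_weak_derivative_imp_AE_primitive:
  assumes "has_weak_derivative f g"
  shows "\<exists>k. AE x in lborel. f x = k + (LBINT t=ereal 0..ereal x. g t)"
proof -
  from assms have f: "locally_integrable f" and g: "locally_integrable g"
    and weak: "\<And>\<psi>. test_function \<psi> \<Longrightarrow> (LINT x|lborel. f x * deriv \<psi> x) = - (LINT x|lborel. g x * \<psi> x)"
    by (auto simp: has_weak_derivative_def)
  define u where "u x = (LBINT t=ereal 0..ereal x. g t)" for x
  have cu: "continuous_on UNIV u"
    unfolding u_def by (rule continuous_on_primitive[OF g])
  have "\<exists>k. AE x in lborel. f x - u x = k"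
  proof (rule weak_derivative_zero_imp_AE_const)
    show "locally_integrable (\<lambda>x. f x - u x)"
      by (intro locally_integrable_diff f continuous_imp_locally_integrable cu)
    fix \<psi> assume \<psi>: "test_function \<psi>"
    have diff: "(deriv ^^ n) \<psi> differentiable (at x)" for n x
      using \<psi> by (simp add: test_function_def)
    obtain R0 where "\<And>x. \<bar>x\<bar> > R0 \<Longrightarrow> \<psi> x = 0"
      using \<psi> by (auto simp: test_function_def)
    then obtain R where R: "R \<ge> 0" "\<And>x. \<bar>x\<bar> > R \<Longrightarrow> \<psi> x = 0"
      by (metis abs_ge_zero abs_ge_self order.strict_trans1)
    have D: "(\<psi> has_real_derivative deriv \<psi> x) (at x)" for x
      using diff[of 0 x] by (simp add: DERIV_deriv_iff_real_differentiable)
    have "isCont (deriv \<psi>) x" for x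
      using diff[of 1 x] by (simp add: differentiable_imp_continuous_within)
    then have cD: "continuous_on UNIV (deriv \<psi>)" by (simp add: continuous_on_eq_continuous_at)
    have c\<psi>: "continuous_on UNIV \<psi>"
      using D by (meson DERIV_isCont continuous_at_imp_continuous_on)
    have zD: "deriv \<psi> x = 0" if "\<bar>x\<bar> > R" for x
    proof -
      have "((\<lambda>_. 0) has_real_derivative 0) (at x)" by simp
      then have "(\<psi> has_real_derivative 0) (at x)"
        by (rule has_field_derivative_transform_within_open[where S="{y. \<bar>y\<bar> > R}"])
           (use that R in \<open>auto intro!: open_Collect_less continuous_intros\<close>)
      then show ?thesis by (rule DERIV_imp_deriv)
    qed
    have lf: "locally_integrable (\<lambda>x. f x * deriv \<psi> x)"
      using locally_integrable_continuous_mult[OF cD f] by (simp add: mult.commute)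
    have lu: "locally_integrable (\<lambda>x. u x * deriv \<psi> x)"
      by (intro continuous_imp_locally_integrable continuous_intros cu cD)
    have lg: "locally_integrable (\<lambda>x. g x * \<psi> x)"
      using locally_integrable_continuous_mult[OF c\<psi> g] by (simp add: mult.commute)
    \<comment> \<open>\<open>\<psi>\<close> is known to vanish only strictly outside [-R, R];
      enlarging the interval kills the boundary terms.\<close>
    define R' where "R' = R + 1"
    have R': "R' \<ge> 0" "\<psi> R' = 0" "\<psi> (-R') = 0"
      using R by (auto simp: R'_def)
    have z: "\<psi> x = 0" "deriv \<psi> x = 0" if "\<bar>x\<bar> > R'" for x
      using that R(2)[of x] zD[of x] by (auto simp: R'_def)
    have "(LBINT t=ereal (-R')..ereal R'. g t * \<psi> t) + (LBINT t=ereal (-R')..ereal R'. u t * deriv \<psi> t) = u R' * \<psi> R' - u (-R') * \<psi> (-R')"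
      using integration_by_parts_primitive[OF g D cD, of "-R'" R' 0 0] R' by (simp add: u_def)
    then have ibp: "(LINT t|lborel. g t * \<psi> t) + (LINT t|lborel. u t * deriv \<psi> t) = 0"
      using R' z by (subst (1 2) integral_compact_support(2)[of _ R']) (auto intro: lg lu)
    have "(LINT x|lborel. (f x - u x) * deriv \<psi> x) = (LINT x|lborel. f x * deriv \<psi> x - u x * deriv \<psi> x)"
      by (simp add: left_diff_distrib)
    also have "\<dots> = (LINT x|lborel. f x * deriv \<psi> x) - (LINT x|lborel. u x * deriv \<psi> x)"
      by (intro Bochner_Integration.integral_diff integral_compact_support(1)[of _ R'] lf lu) (use z R' in auto)
    also have "\<dots> = 0" using weak[OF \<psi>] ibp by simp
    finally show "(LINT x|lborel. (f x - u x) * deriv \<psi> x) = 0" .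
  qed
  then obtain k where "AE x in lborel. f x - u x = k" by blast
  then have "AE x in lborel. f x = k + (LBINT t=ereal 0..ereal x. g t)"
    by eventually_elim (simp add: u_def)
  then show ?thesis by blast
qed

text \<open>Where a nonnegative primitive vanishes, its derivative vanishes almost everywhere. This is seen
  by letting \<open>\<epsilon> \<longrightarrow> 0\<close> in the chain rule for \<open>s - \<epsilon> * ln (s + \<epsilon>)\<close>.\<close>

lemma integral_primitive_positive_set:
  fixes k c a b :: real and g :: "real \<Rightarrow> real"
  defines "u \<equiv> \<lambda>x. k + (LBINT t=ereal c..ereal x. g t)"
  assumes g: "locally_integrable g" and nonneg: "\<And>x. 0 \<le> u x" and "a \<le> b"
  shows "(LINT t:{a..b}|lborel. if u t > 0 then g t else 0) = u b - u a"
proof -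
  have cu: "continuous_on UNIV u"
    unfolding u_def by (intro continuous_intros continuous_on_primitive g)
  note [measurable] = borel_measurable_continuous_onI[OF cu] locally_integrable_measurable[OF g]
  define e where "e n = 1 / real (Suc n)" for n
  have e: "e n > 0" for n by (simp add: e_def)
  have e0: "e \<longlonglongrightarrow> 0" unfolding e_def by (rule LIMSEQ_Suc[OF lim_1_over_n])
  \<comment> \<open>The derivative is s / (s + e n): for s \<ge> 0 it lies in [0, 1] and tends to
    the indicator of s > 0, while \<open>\<eta> n s\<close> tends to s, at s = 0 because x ln x
    tends to 0. Its Lipschitz constant 1 / e n blows up, which is harmless since the chain rule is
    applied for each n separately.\<close>
  define \<eta> where "\<eta> n s = s - e n * ln (s + e n)" for n s
  define \<eta>' where "\<eta>' n s = 1 - e n / (s + e n)" for n s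
  have eq: "\<eta> n (u b) - \<eta> n (u a) = (LINT t:{a..b}|lborel. \<eta>' n (u t) * g t)" for n
  proof -
    have "\<eta> n (u b) - \<eta> n (u a) = (LBINT t=ereal a..ereal b. \<eta>' n (u t) * g t)"
      unfolding u_def
    proof (rule chain_rule_primitive(2)[where S="{0..}" and L="1 / e n"])
      show "k + (LBINT t=ereal c..ereal x. g t) \<in> {0..}" for x using nonneg by (simp add: u_def)
      show "(\<eta> n has_real_derivative \<eta>' n s) (at s)" if "s \<in> {0..}" for s
        unfolding \<eta>_def \<eta>'_def using that e[of n] by (auto intro!: derivative_eq_intros)
      show "\<bar>\<eta>' n s - \<eta>' n t\<bar> \<le> 1 / e n * \<bar>s - t\<bar>" if "s \<in> {0..}" "t \<in> {0..}" for s t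
      proof -
        have pos: "s + e n > 0" "t + e n > 0" using that e[of n] by auto
        have "\<eta>' n s - \<eta>' n t = e n * (s - t) / ((s + e n) * (t + e n))"
          unfolding \<eta>'_def using pos by (simp add: field_simps)
        then have "\<bar>\<eta>' n s - \<eta>' n t\<bar> = e n * \<bar>s - t\<bar> / ((s + e n) * (t + e n))"
          using pos e[of n] by (simp add: abs_mult)
        also have "\<dots> \<le> e n * \<bar>s - t\<bar> / (e n * e n)"
          using that e[of n] by (intro divide_left_mono mult_mono mult_pos_pos) auto
        also have "\<dots> = 1 / e n * \<bar>s - t\<bar>" using e[of n] by simp
        finally show ?thesis .
      qed
    qed (use e[of n] \<open>a \<le> b\<close> g in \<open>auto simp: is_interval_ci\<close>)
    then show ?thesis using \<open>a \<le> b\<close> by (simp add: interval_integral_Icc)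
  qed
  have \<eta>lim: "(\<lambda>n. \<eta> n s) \<longlonglongrightarrow> s" if "s \<ge> 0" for s
  proof (cases "s = 0")
    case True
    have "((\<lambda>x::real. x * ln x) \<longlongrightarrow> 0) (at_right 0)" by real_asymp
    moreover have "filterlim e (at_right 0) sequentially"
      using e0 e by (auto simp: filterlim_at intro!: always_eventually) (metis less_irrefl)
    ultimately have "(\<lambda>n. e n * ln (e n)) \<longlonglongrightarrow> 0" by (rule filterlim_compose)
    then have "(\<lambda>n. - (e n * ln (e n))) \<longlonglongrightarrow> - 0" by (rule tendsto_minus)
    with True show ?thesis by (simp add: \<eta>_def)
  next
    case False
    then have "(\<lambda>n. s - e n * ln (s + e n)) \<longlonglongrightarrow> s - 0 * ln (s + 0)"
      using that by (intro tendsto_intros e0) auto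
    then show ?thesis by (simp add: \<eta>_def)
  qed
  have \<eta>'lim: "(\<lambda>n. \<eta>' n s) \<longlonglongrightarrow> (if s > 0 then 1 else 0)" if "s \<ge> 0" for s
  proof (cases "s = 0")
    case True
    then show ?thesis using e by (simp add: \<eta>'_def less_imp_neq[symmetric])
  next
    case False
    then have "(\<lambda>n. 1 - e n / (s + e n)) \<longlonglongrightarrow> 1 - 0 / (s + 0)"
      using that by (intro tendsto_intros e0) auto
    then show ?thesis using False that by (simp add: \<eta>'_def)
  qed
  have \<eta>'bnd: "\<bar>\<eta>' n s\<bar> \<le> 1" if "s \<ge> 0" for n s
    using that e[of n] by (auto simp: \<eta>'_def abs_if field_simps)
  have "(\<lambda>n. LINT t:{a..b}|lborel. \<eta>' n (u t) * g t) \<longlonglongrightarrow> (LINT t:{a..b}|lborel. if u t > 0 then g t else 0)"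
    unfolding set_lebesgue_integral_def
  proof (rule integral_dominated_convergence)
    show "integrable lborel (\<lambda>x. indicator {a..b} x *\<^sub>R \<bar>g x\<bar>)"
      using locally_integrableD[OF locally_integrable_abs[OF g]] by (simp add: set_integrable_def)
    show "AE x in lborel. (\<lambda>n. indicator {a..b} x *\<^sub>R (\<eta>' n (u x) * g x))
        \<longlonglongrightarrow> indicator {a..b} x *\<^sub>R (if 0 < u x then g x else 0)"
    proof (rule AE_I2)
      fix x
      have "(\<lambda>n. indicator {a..b} x *\<^sub>R (\<eta>' n (u x) * g x)) \<longlonglongrightarrow> indicator {a..b} x *\<^sub>R ((if 0 < u x then 1 else 0) * g x)"
        by (intro tendsto_intros \<eta>'lim nonneg)
      then show "(\<lambda>n. indicator {a..b} x *\<^sub>R (\<eta>' n (u x) * g x)) \<longlonglongrightarrow> indicator {a..b} x *\<^sub>R (if 0 < u x then g x else 0)"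
        by (simp split: if_splits)
    qed
    show "AE x in lborel. norm (indicator {a..b} x *\<^sub>R (\<eta>' n (u x) * g x)) \<le> indicator {a..b} x *\<^sub>R \<bar>g x\<bar>" for n
      using \<eta>'bnd[OF nonneg] by (auto simp: abs_mult indicator_def mult_left_le_one_le)
    show "(\<lambda>x. indicator {a..b} x *\<^sub>R (\<eta>' n (u x) * g x)) \<in> borel_measurable lborel" for n
      unfolding \<eta>'_def by measurable
  qed measurable
  moreover have "(\<lambda>n. \<eta> n (u b) - \<eta> n (u a)) \<longlonglongrightarrow> u b - u a"
    by (intro tendsto_diff \<eta>lim nonneg)
  ultimately show ?thesis
    unfolding eq using LIMSEQ_unique by blast
qed

subsection \<open>Monotone scores\<close>

lemma prob_density_measurable: "prob_density f \<Longrightarrow> f \<in> borel_measurable borel"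
  unfolding prob_density_def by (auto dest: borel_measurable_integrable)

lemma cdf_distribution_prob_density:
  assumes "prob_density f"
  shows "cdf_distribution (density lborel (\<lambda>x. ennreal (f x)))"
proof -
  note [measurable] = prob_density_measurable[OF assms]
  have "(\<integral>\<^sup>+x. ennreal (f x) \<partial>lborel) = ennreal (LINT x|lborel. f x)"
    by (rule nn_integral_eq_integral) (use assms in \<open>auto simp: prob_density_def\<close>)
  then have "(\<integral>\<^sup>+x. ennreal (f x) \<partial>lborel) = 1"
    using assms by (simp add: prob_density_def)
  then have "prob_space (density lborel (\<lambda>x. ennreal (f x)))"
    by (intro prob_spaceI) (simp add: emeasure_density)
  then show ?thesis
    by (auto simp: cdf_distribution_def real_distribution_def real_distribution_axioms_def)
qed

lemma quantile_dist_fun: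
  "quantile (dist_fun f) u = Inf {x. u \<le> cdf (density lborel (\<lambda>x. ennreal (f x))) x}"
  by (simp add: quantile_def dist_fun_def)

lemma quantile_le_iff:
  assumes "prob_density f" "0 < u" "u < 1"
  shows "quantile (dist_fun f) u \<le> x \<longleftrightarrow> u \<le> dist_fun f x"
proof -
  interpret cdf_distribution "density lborel (\<lambda>x. ennreal (f x))"
    by (rule cdf_distribution_prob_density[OF assms(1)])
  show ?thesis
    unfolding quantile_def dist_fun_def by (rule pseudoinverse[OF assms(2,3), symmetric])
qed

lemma isCont_dist_fun:
  assumes "prob_density f"
  shows "isCont (dist_fun f) x"
proof -
  interpret cdf_distribution "density lborel (\<lambda>x. ennreal (f x))"
    by (rule cdf_distribution_prob_density[OF assms])
  note [measurable] = prob_density_measurable[OF assms]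
  have "emeasure (density lborel (\<lambda>x. ennreal (f x))) {x} = (\<integral>\<^sup>+y\<in>{x}. ennreal (f y) \<partial>lborel)"
    by (simp add: emeasure_density)
  also have "\<dots> = 0"
    using AE_lborel_singleton[of x] by (subst nn_integral_0_iff_AE) (auto simp: indicator_def)
  finally have "measure (density lborel (\<lambda>x. ennreal (f x))) {x} = 0"
    by (simp add: measure_def)
  then show ?thesis
    unfolding dist_fun_def using isCont_cdf by simp
qed

text \<open>To the left of the quantile the distribution function stays below u, and having no jump
  it cannot overshoot u there.\<close>

lemma dist_fun_quantile:
  assumes "prob_density f" "0 < u" "u < 1"
  shows "dist_fun f (quantile (dist_fun f) u) = u"
proof (rule antisym)
  let ?q = "quantile (dist_fun f) u"
  show "u \<le> dist_fun f ?q"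
    using quantile_le_iff[OF assms] by blast
  have "(dist_fun f \<longlongrightarrow> dist_fun f ?q) (at_left ?q)"
    using isCont_dist_fun[OF assms(1), of ?q] by (simp add: isCont_def filterlim_at_split)
  moreover have "\<forall>\<^sub>F x in at_left ?q. dist_fun f x \<le> u"
    unfolding eventually_at_filter
  proof (rule always_eventually, intro allI impI)
    fix x assume "x \<in> {..<?q}"
    then have "\<not> ?q \<le> x" by simp
    then show "dist_fun f x \<le> u" unfolding quantile_le_iff[OF assms] by simp
  qed
  ultimately show "dist_fun f ?q \<le> u"
    by (rule tendsto_upperbound) auto
qed

lemma mono_on_quantile:
  assumes "prob_density f"
  shows "mono_on {0<..<1} (quantile (dist_fun f))"
proof (rule mono_onI)
  fix r s :: real assume "r \<in> {0<..<1}" "s \<in> {0<..<1}" "r \<le> s"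
  then show "quantile (dist_fun f) r \<le> quantile (dist_fun f) s"
    using dist_fun_quantile[OF assms, of s] by (subst quantile_le_iff[OF assms]) auto
qed

text \<open>Scores and quantiles are controlled only on the open unit interval. This is why
  measurability is always stated for the product with its indicator.\<close>

lemma mono_on_Ioo_measurable:
  fixes D :: "real \<Rightarrow> real"
  assumes "mono_on {0<..<1} D"
  shows "(\<lambda>u. indicator {0<..<1} u * D u) \<in> borel_measurable borel"
  using borel_measurable_mono_on_fnc[OF assms] by (simp add: borel_measurable_restrict_space_iff)

text \<open>The quantile function of a uniform variable has density \<open>f\<close>. All integrals
  over (0, 1) below are computed on the real line in this way.\<close>

lemma quantile_transform:
  fixes h :: "real \<Rightarrow> real"
  assumes f: "prob_density f" and [measurable]: "h \<in> borel_measurable borel"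
  shows "set_integrable lborel {0<..<1} (\<lambda>u. h (quantile (dist_fun f) u)) \<longleftrightarrow> integrable lborel (\<lambda>x. f x * h x)"
    and "(LINT u:{0<..<1}|lborel. h (quantile (dist_fun f) u)) = (LINT x|lborel. f x * h x)"
proof -
  let ?M = "density lborel (\<lambda>x. ennreal (f x))" and ?Q = "quantile (dist_fun f)"
  interpret cdf_distribution ?M by (rule cdf_distribution_prob_density[OF f])
  note [measurable] = prob_density_measurable[OF f]
  have nn: "AE x in lborel. 0 \<le> f x" using f by (simp add: prob_density_def)
  have D: "distr (restrict_space lborel {0<..<1}) borel ?Q = ?M"
    using distr_I_eq_M by (simp add: quantile_dist_fun[abs_def])
  have Q: "?Q \<in> borel_measurable (restrict_space lborel {0<..<1})"
    using borel_measurable_mono_on_fnc[OF mono_on_quantile[OF f]]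
    by (simp cong: measurable_cong_sets add: sets_restrict_space)
  have "integrable ?M h \<longleftrightarrow> integrable (restrict_space lborel {0<..<1}) (\<lambda>u. h (?Q u))"
    unfolding D[symmetric] by (rule integrable_distr_eq[OF Q]) simp
  then show "set_integrable lborel {0<..<1} (\<lambda>u. h (?Q u)) \<longleftrightarrow> integrable lborel (\<lambda>x. f x * h x)"
    using integrable_real_density[OF _ nn, of h]
    by (simp add: set_integrable_def integrable_restrict_space)
  have "integral\<^sup>L ?M h = (LINT u|restrict_space lborel {0<..<1}. h (?Q u))"
    unfolding D[symmetric] by (rule integral_distr[OF Q]) simp
  then show "(LINT u:{0<..<1}|lborel. h (?Q u)) = (LINT x|lborel. f x * h x)"
    using integral_real_density[OF _ nn, of h]
    by (simp add: set_lebesgue_integral_def integral_restrict_space)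
qed

lemma AE_lborel_Ex:
  fixes a b :: real
  assumes "AE x in lborel. P x" "a < b"
  obtains x where "a < x" "x < b" "P x"
proof (rule ccontr)
  assume "\<not> thesis"
  with that have no: "\<And>x. a < x \<Longrightarrow> x < b \<Longrightarrow> \<not> P x" by blast
  have "AE x in lborel. \<not> (a < x \<and> x < b)"
    using assms(1) by eventually_elim (use no in blast)
  then have "emeasure lborel {x \<in> space lborel. a < x \<and> x < b} = 0"
    by (rule emeasure_eq_0_AE)
  moreover have "{x \<in> space lborel. a < x \<and> x < b} = {a<..<b}" by auto
  ultimately show False using assms(2) by simp
qed

text \<open>If \<open>u x\<close> were outside \<open>C\<close>, then \<open>u\<close> would avoid
  \<open>C\<close> on a ball inside \<open>U\<close>, and this ball contains a point where
  \<open>u\<close> and \<open>f\<close> agree. It transfers pointwise bounds from a density to its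
  continuous version.\<close>

lemma continuous_AE_eq_closed:
  fixes u f :: "real \<Rightarrow> real"
  assumes u: "continuous_on UNIV u" and ae: "AE x in lborel. f x = u x"
    and "open U" "closed C" "\<And>x. x \<in> U \<Longrightarrow> f x \<in> C" "x \<in> U"
  shows "u x \<in> C"
proof (rule ccontr)
  assume "u x \<notin> C"
  have "open (u -` (- C) \<inter> U)"
    using assms by (intro open_Int open_vimage) auto
  moreover have "x \<in> u -` (- C) \<inter> U" using \<open>u x \<notin> C\<close> \<open>x \<in> U\<close> by auto
  ultimately obtain d where "d > 0" and d: "ball x d \<subseteq> u -` (- C) \<inter> U"
    using open_contains_ball by meson
  obtain y where y: "x - d < y" "y < x + d" "f y = u y"
    using AE_lborel_Ex[OF ae, of "x - d" "x + d"] \<open>d > 0\<close> by auto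
  then have "y \<in> ball x d" by (auto simp: dist_real_def)
  with d have "u y \<notin> C" "y \<in> U" by blast+
  then show False using assms(5)[of y] y by simp
qed

section \<open>The location score of a density that vanishes at infinity\<close>

text \<open>After the quantile transform the integrand is \<open>f * loc_score f\<close>, which is
  -v' for the continuous version \<open>v\<close> of the density. So the tail beyond t integrates to
  \<open>v\<close> at the t-quantile, and the whole integral is the difference of two zero
  limits.\<close>

lemma class_F0_score:
  assumes "f \<in> class_F0"
  defines "\<phi> \<equiv> \<lambda>u. loc_score f (quantile (dist_fun f) u)"
  shows score_square_integrable: "set_integrable lborel {0<..<1} (\<lambda>u. (\<phi> u)\<^sup>2)"
    and score_integrable: "set_integrable lborel {0<..<1} \<phi>"
    and score_integral_zero: "(LINT u:{0<..<1}|lborel. \<phi> u) = 0"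
    and score_tail_nonneg: "0 \<le> (LINT u:{0<..<1}|lborel. if t < u then \<phi> u else 0)"
proof -
  let ?Q = "quantile (dist_fun f)"
  from assms(1) have f: "prob_density f" and ex: "\<exists>g. has_weak_derivative f g"
    and fisher: "fisher_info f < \<infinity>" and lim: "(f \<longlongrightarrow> 0) at_top" "(f \<longlongrightarrow> 0) at_bot"
    by (auto simp: class_F0_def class_F_def)
  \<comment> \<open>With the chosen version itself as \<open>g\<close>, the score is literally -g /
    f, and no two versions have to be compared.\<close>
  define g where "g = weak_deriv f"
  have wd: "has_weak_derivative f g"
    using someI_ex[OF ex] by (simp add: g_def weak_deriv_def)
  then have g: "locally_integrable g" by (simp add: has_weak_derivative_def)
  obtain k where ae: "AE x in lborel. f x = k + (LBINT t=ereal 0..ereal x. g t)"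
    using has_weak_derivative_imp_AE_primitive[OF wd] by blast
  define v where "v x = k + (LBINT t=ereal 0..ereal x. g t)" for x
  have ae: "AE x in lborel. f x = v x" using ae by (simp add: v_def)
  have cv: "continuous_on UNIV v"
    unfolding v_def by (intro continuous_intros continuous_on_primitive g)
  have v_nonneg: "0 \<le> v x" for x
    using continuous_AE_eq_closed[OF cv ae, of UNIV "{0..}" x] f by (auto simp: prob_density_def)
  have v_top: "(v \<longlongrightarrow> 0) at_top"
  proof (rule tendstoI)
    fix e :: real assume "e > 0"
    then have "\<forall>\<^sub>F x in at_top. dist (f x) 0 < e / 2" by (intro tendstoD lim) auto
    then obtain X where X: "\<And>x. x \<ge> X \<Longrightarrow> \<bar>f x\<bar> < e / 2"
      by (auto simp: eventually_at_top_linorder)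
    \<comment> \<open>Only closed conditions pass to \<open>v\<close>; the radius e / 2 restores the
      strict inequality.\<close>
    have "v x \<in> cball 0 (e / 2)" if "x > X" for x
      by (rule continuous_AE_eq_closed[OF cv ae, of "{X<..}"]) (use X that in \<open>auto simp: less_imp_le\<close>)
    then show "\<forall>\<^sub>F x in at_top. dist (v x) 0 < e"
      using \<open>e > 0\<close> by (intro eventually_mono[OF eventually_gt_at_top[of X]]) fastforce
  qed
  have v_bot: "(v \<longlongrightarrow> 0) at_bot"
  proof (rule tendstoI)
    fix e :: real assume "e > 0"
    then have "\<forall>\<^sub>F x in at_bot. dist (f x) 0 < e / 2" by (intro tendstoD lim) auto
    then obtain X where X: "\<And>x. x \<le> X \<Longrightarrow> \<bar>f x\<bar> < e / 2"
      by (auto simp: eventually_at_bot_linorder)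
    have "v x \<in> cball 0 (e / 2)" if "x < X" for x
      by (rule continuous_AE_eq_closed[OF cv ae, of "{..<X}"]) (use X that in \<open>auto simp: less_imp_le\<close>)
    then show "\<forall>\<^sub>F x in at_bot. dist (v x) 0 < e"
      using \<open>e > 0\<close> by (intro eventually_mono[OF eventually_gt_at_bot[of X]]) fastforce
  qed
  note [measurable] = locally_integrable_measurable[OF g] prob_density_measurable[OF f]
    borel_measurable_continuous_onI[OF cv]
  have score_meas [measurable]: "loc_score f \<in> borel_measurable borel"
    unfolding loc_score_def g_def[symmetric] by measurable
  have [measurable]: "(\<lambda>u. indicator {0<..<1} u * ?Q u) \<in> borel_measurable borel"
    by (rule mono_on_Ioo_measurable[OF mono_on_quantile[OF f]])
  have \<phi>_eq: "indicator {0<..<1} u * h (\<phi> u) = indicator {0<..<1} u * h (loc_score f (indicator {0<..<1} u * ?Q u))"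
    for u and h :: "real \<Rightarrow> real" by (simp add: \<phi>_def indicator_def)
  have \<phi>_meas: "(\<lambda>u. indicator {0<..<1} u * h (\<phi> u)) \<in> borel_measurable borel"
    if [measurable]: "h \<in> borel_measurable borel" for h :: "real \<Rightarrow> real"
    unfolding \<phi>_eq by measurable
  show L2: "set_integrable lborel {0<..<1} (\<lambda>u. (\<phi> u)\<^sup>2)"
    unfolding set_integrable_def
  proof (rule integrableI_nonneg)
    have "(\<integral>\<^sup>+u. ennreal (indicator {0<..<1} u *\<^sub>R (\<phi> u)\<^sup>2) \<partial>lborel) = fisher_info f"
      unfolding fisher_info_def \<phi>_def by (intro nn_integral_cong) (simp add: indicator_def)
    then show "(\<integral>\<^sup>+u. ennreal (indicator {0<..<1} u *\<^sub>R (\<phi> u)\<^sup>2) \<partial>lborel) < \<infinity>"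
      using fisher by simp
  qed (use \<phi>_meas[of "\<lambda>x. x\<^sup>2"] in auto)
  have one: "set_integrable lborel {0<..<1::real} (\<lambda>u. 1 :: real)"
    by (simp add: set_integrable_def)
  show L1: "set_integrable lborel {0<..<1} \<phi>"
  proof (rule set_integrable_bound[OF set_integral_add(1)[OF one L2]])
    have "\<bar>x\<bar> \<le> 1 + x\<^sup>2" for x :: real
      using sum_squares_bound[of 1 "\<bar>x\<bar>"] by simp
    then show "AE u in lborel. u \<in> {0<..<1} \<longrightarrow> norm (\<phi> u) \<le> norm (1 + (\<phi> u)\<^sup>2)"
      by auto
  qed (use \<phi>_meas[of "\<lambda>x. x"] in \<open>simp add: set_borel_measurable_def\<close>)
  \<comment> \<open>Where \<open>f\<close> vanishes, so does \<open>f * loc_score f\<close>; the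
    cut-off reproduces this. By the result on the zero set, \<open>w\<close> still integrates to the
    increments of \<open>v\<close>.\<close>
  define w where "w x = (if v x > 0 then g x else 0)" for x
  have [measurable]: "w \<in> borel_measurable borel" unfolding w_def by measurable
  have fw: "AE x in lborel. f x * loc_score f x = - w x"
    using ae by eventually_elim (use v_nonneg in \<open>auto simp: loc_score_def w_def g_def[symmetric] less_le\<close>)
  have "integrable lborel (\<lambda>x. f x * loc_score f x)"
    using L1 quantile_transform(1)[OF f score_meas] by (simp add: \<phi>_def)
  moreover have "integrable lborel (\<lambda>x. f x * loc_score f x) \<longleftrightarrow> integrable lborel (\<lambda>x. - w x)"
    by (rule integrable_cong_AE[OF _ _ fw]) simp_all
  ultimately have "integrable lborel (\<lambda>x. - w x)" by simp
  from Bochner_Integration.integrable_minus[OF this] have w: "integrable lborel w" by simp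
  have ws: "set_integrable lborel A w" if "A \<in> sets borel" for A
    by (rule set_integrable_subset[where A=UNIV]) (use w that in \<open>auto simp: set_integrable_def\<close>)
  have wv: "(LINT x:{a..b}|lborel. w x) = v b - v a" if "a \<le> b" for a b
    using integral_primitive_positive_set[OF g, of k 0 a b] v_nonneg that by (simp add: v_def w_def)
  \<comment> \<open>The limits of \<open>v\<close> at infinity extend the increment formula to
    half-lines.\<close>
  have right: "(LINT x:{q..}|lborel. w x) = - v q" for q
  proof (rule tendsto_unique)
    show "((\<lambda>b. LINT x:{q..b}|lborel. w x) \<longlongrightarrow> (LINT x:{q..}|lborel. w x)) at_top"
      by (intro tendsto_set_lebesgue_integral_at_top ws) auto
    have "((\<lambda>b. v b - v q) \<longlongrightarrow> 0 - v q) at_top" by (intro tendsto_intros v_top)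
    then have "((\<lambda>b. v b - v q) \<longlongrightarrow> - v q) at_top" by simp
    then show "((\<lambda>b. LINT x:{q..b}|lborel. w x) \<longlongrightarrow> - v q) at_top"
      by (rule Lim_transform_eventually) (rule eventually_mono[OF eventually_ge_at_top[of q]], simp add: wv)
  qed simp
  have left: "(LINT x:{..q}|lborel. w x) = v q" for q
  proof (rule tendsto_unique)
    show "((\<lambda>a. LINT x:{a..q}|lborel. w x) \<longlongrightarrow> (LINT x:{..q}|lborel. w x)) at_bot"
      by (intro tendsto_set_lebesgue_integral_at_bot ws) auto
    have "((\<lambda>a. v q - v a) \<longlongrightarrow> v q - 0) at_bot" by (intro tendsto_intros v_bot)
    then have "((\<lambda>a. v q - v a) \<longlongrightarrow> v q) at_bot" by simp
    then show "((\<lambda>a. LINT x:{a..q}|lborel. w x) \<longlongrightarrow> v q) at_bot"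
      by (rule Lim_transform_eventually) (rule eventually_mono[OF eventually_le_at_bot[of q]], simp add: wv)
  qed simp
  have AE0: "AE x in lborel. x \<noteq> (q::real)" for q by (rule AE_lborel_singleton)
  have open_right: "(LINT x:{q<..}|lborel. w x) = - v q" for q
    unfolding right[symmetric] set_lebesgue_integral_def
    by (rule integral_cong_AE) (use AE0[of q] in \<open>auto simp: indicator_def\<close>)
  have "(LINT x|lborel. w x) = (LINT x:({..0} \<union> {0<..})|lborel. w x)"
    unfolding set_lebesgue_integral_def by (rule Bochner_Integration.integral_cong) (auto simp: indicator_def)
  also have "\<dots> = (LINT x:{..0}|lborel. w x) + (LINT x:{0<..}|lborel. w x)"
    by (rule set_integral_Un) (auto intro: ws)
  finally have total: "(LINT x|lborel. w x) = 0" by (simp add: left open_right)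
  have "(LINT u:{0<..<1}|lborel. \<phi> u) = (LINT x|lborel. f x * loc_score f x)"
    unfolding \<phi>_def by (rule quantile_transform(2)[OF f score_meas])
  also have "\<dots> = (LINT x|lborel. - w x)"
    by (rule integral_cong_AE[OF _ _ fw]) auto
  finally show zero: "(LINT u:{0<..<1}|lborel. \<phi> u) = 0" using total by simp
  show "0 \<le> (LINT u:{0<..<1}|lborel. if t < u then \<phi> u else 0)"
  proof -
    consider "t \<le> 0" | "0 < t" "t < 1" | "1 \<le> t" by linarith
    then show ?thesis
    proof cases
      case 1
      then have "(LINT u:{0<..<1}|lborel. if t < u then \<phi> u else 0) = (LINT u:{0<..<1}|lborel. \<phi> u)"
        unfolding set_lebesgue_integral_def by (intro Bochner_Integration.integral_cong) (auto simp: indicator_def)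
      then show ?thesis by (simp add: zero)
    next
      case 3
      then have "(LINT u:{0<..<1}|lborel. if t < u then \<phi> u else 0) = (LINT u::real|lborel. 0 :: real)"
        unfolding set_lebesgue_integral_def by (intro Bochner_Integration.integral_cong) (auto simp: indicator_def)
      then show ?thesis by simp
    next
      case 2
      define q where "q = ?Q t"
      \<comment> \<open>The equivalence is exact, even where the distribution function is flat,
        because it takes the value t at q.\<close>
      have iff: "t < u \<longleftrightarrow> q < ?Q u" if "u \<in> {0<..<1}" for u
      proof -
        have "?Q u \<le> q \<longleftrightarrow> u \<le> t"
          using quantile_le_iff[OF f, of u q] dist_fun_quantile[OF f 2] that by (simp add: q_def)
        then show ?thesis by linarith
      qed
      have "(LINT u:{0<..<1}|lborel. if t < u then \<phi> u else 0) =
          (LINT u:{0<..<1}|lborel. (\<lambda>x. indicator {q<..} x * loc_score f x) (?Q u))"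
        unfolding set_lebesgue_integral_def \<phi>_def
        by (intro Bochner_Integration.integral_cong) (use iff in \<open>auto simp: indicator_def\<close>)
      also have "\<dots> = (LINT x|lborel. f x * (indicator {q<..} x * loc_score f x))"
        by (rule quantile_transform(2)[OF f]) auto
      also have "\<dots> = (LINT x|lborel. - (indicator {q<..} x * w x))"
      proof (rule integral_cong_AE)
        show "AE x in lborel. f x * (indicator {q<..} x * loc_score f x) = - (indicator {q<..} x * w x)"
          using fw by eventually_elim (auto simp: indicator_def)
      qed auto
      also have "\<dots> = v q"
        using open_right[of q] by (simp add: set_lebesgue_integral_def)
      finally show ?thesis using v_nonneg by simp
    qed
  qed
qed

section \<open>Nonnegativity for nondecreasing scores\<close>

text \<open>The set where D > s is closed upwards in (0, 1), so it is a tail interval up to its left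
  endpoint, a null set.\<close>

lemma score_upper_level_nonneg:
  fixes D :: "real \<Rightarrow> real"
  assumes f: "f \<in> class_F0" and D: "mono_on {0<..<1} D"
  shows "0 \<le> (LINT u:{0<..<1}|lborel. if s < D u then loc_score f (quantile (dist_fun f) u) else 0)"
proof -
  define \<phi> where "\<phi> = (\<lambda>u. loc_score f (quantile (dist_fun f) u))"
  define A where "A = {u \<in> {0<..<1}. s < D u}"
  note D01 [measurable] = mono_on_Ioo_measurable[OF D]
  have \<phi>01 [measurable]: "(\<lambda>u. indicator {0<..<1} u * \<phi> u) \<in> borel_measurable borel"
    using score_integrable[OF f] by (auto simp: \<phi>_def set_integrable_def dest: borel_measurable_integrable)
  show ?thesis
  proof (cases "A = {}")
    case True
    have "(LINT u:{0<..<1}|lborel. if s < D u then \<phi> u else 0) = (LINT u::real|lborel. 0 :: real)"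
      unfolding set_lebesgue_integral_def
      by (rule Bochner_Integration.integral_cong[OF refl]) (use True in \<open>auto simp: A_def indicator_def\<close>)
    then show ?thesis unfolding \<phi>_def by simp
  next
    case False
    define t where "t = Inf A"
    have bdd: "bdd_below A" by (rule bdd_belowI[of _ 0]) (simp add: A_def)
    have ge: "t \<le> u" if "u \<in> A" for u
      unfolding t_def by (rule cInf_lower[OF that bdd])
    have above: "u \<in> A" if "t < u" "u \<in> {0<..<1}" for u
    proof -
      have "\<exists>x\<in>A. x < u"
        using that(1) unfolding t_def cInf_less_iff[OF False bdd] .
      then obtain x where "x \<in> A" "x < u" by blast
      then show ?thesis
        using mono_onD[OF D, of x u] that(2) unfolding A_def by fastforce
    qed
    have "(LINT u:{0<..<1}|lborel. if s < D u then \<phi> u else 0) = (LINT u:{0<..<1}|lborel. if t < u then \<phi> u else 0)"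
      unfolding set_lebesgue_integral_def
    proof (rule integral_cong_AE)
      have "(\<lambda>u. indicator {0<..<1} u *\<^sub>R (if s < D u then \<phi> u else 0)) =
          (\<lambda>u. if s < indicator {0<..<1} u * D u then indicator {0<..<1} u * \<phi> u else 0)"
        by (rule ext) (simp add: indicator_def)
      then show "(\<lambda>u. indicator {0<..<1} u *\<^sub>R (if s < D u then \<phi> u else 0)) \<in> borel_measurable lborel"
        by (simp only:) measurable
      have "(\<lambda>u. indicator {0<..<1} u *\<^sub>R (if t < u then \<phi> u else 0)) =
          (\<lambda>u. if t < u then indicator {0<..<1} u * \<phi> u else 0)"
        by (rule ext) simp
      then show "(\<lambda>u. indicator {0<..<1} u *\<^sub>R (if t < u then \<phi> u else 0)) \<in> borel_measurable lborel"
        by (simp only:) measurable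
      have "AE u in lborel. u \<noteq> t" by (rule AE_lborel_singleton)
      then show "AE u in lborel. indicator {0<..<1} u *\<^sub>R (if s < D u then \<phi> u else 0) =
          indicator {0<..<1} u *\<^sub>R (if t < u then \<phi> u else 0)"
      proof eventually_elim
        case (elim u)
        have "s < D u \<longleftrightarrow> t < u" if "u \<in> {0<..<1}"
        proof
          assume "s < D u"
          then have "u \<in> A" using that by (simp add: A_def)
          then show "t < u" using ge[of u] elim by simp
        next
          assume "t < u"
          then have "u \<in> A" using that by (rule above)
          then show "s < D u" by (simp add: A_def)
        qed
        then show ?case by (cases "u \<in> {0<..<1}") simp_all
      qed
    qed
    then show ?thesis using score_tail_nonneg[OF f, of t] unfolding \<phi>_def by simp
  qed
qed

lemma integrable_mult_square_integrable:
  fixes D \<phi> :: "real \<Rightarrow> real"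
  assumes [measurable]: "(\<lambda>u. indicator A u * D u) \<in> borel_measurable borel"
      "(\<lambda>u. indicator A u * \<phi> u) \<in> borel_measurable borel"
    and "set_integrable lborel A (\<lambda>u. (D u)\<^sup>2)" "set_integrable lborel A (\<lambda>u. (\<phi> u)\<^sup>2)"
  shows "set_integrable lborel A (\<lambda>u. D u * \<phi> u)"
proof (rule set_integrable_bound[OF set_integral_add(1)[OF assms(3,4)]])
  have "(\<lambda>u. indicator A u *\<^sub>R (D u * \<phi> u)) = (\<lambda>u. (indicator A u * D u) * (indicator A u * \<phi> u))"
    by (auto simp: indicator_def)
  then show "set_borel_measurable lborel A (\<lambda>u. D u * \<phi> u)"
    by (simp add: set_borel_measurable_def)
  have "\<bar>x * y\<bar> \<le> x\<^sup>2 + y\<^sup>2" for x y :: real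
    using sum_squares_bound[of "\<bar>x\<bar>" "\<bar>y\<bar>"] mult_nonneg_nonneg[of "\<bar>x\<bar>" "\<bar>y\<bar>"]
    unfolding abs_mult power2_abs mult.assoc by linarith
  then show "AE u in lborel. u \<in> A \<longrightarrow> norm (D u * \<phi> u) \<le> norm ((D u)\<^sup>2 + (\<phi> u)\<^sup>2)"
    by auto
qed

text \<open>A layer-cake formula over a bounded range of levels: it recovers d clipped to [-n, n],
  shifted by n because the levels start at -n.\<close>

lemma integral_layer:
  fixes n d :: real
  assumes "n \<ge> 0"
  shows "(LINT s|lborel. indicator {-n..n} s * (if s < d then 1 else 0)) = max (-n) (min n d) + n"
proof -
  have "(LINT s|lborel. indicator {-n..n} s * (if s < d then 1 else 0)) = measure lborel ({-n..n} \<inter> {..<d})"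
  proof -
    have "(\<lambda>s. indicator {-n..n} s * (if s < d then 1 else 0)) = (indicator ({-n..n} \<inter> {..<d}) :: real \<Rightarrow> real)"
      by (auto simp: indicator_def fun_eq_iff)
    then show ?thesis by simp
  qed
  also have "\<dots> = max (-n) (min n d) + n"
  proof -
    consider "d > n" | "d \<le> -n" | "-n < d" "d \<le> n" by linarith
    then show ?thesis
    proof cases
      case 1
      then have "{-n..n} \<inter> {..<d} = {-n..n}" by auto
      then show ?thesis using 1 assms by simp
    next
      case 2
      then have "{-n..n} \<inter> {..<d} = {}" by auto
      then show ?thesis using 2 assms by simp
    next
      case 3
      then have "{-n..n} \<inter> {..<d} = {-n..<d}" by auto
      then show ?thesis using 3 assms by simp
    qed
  qed
  finally show ?thesis .
qed

lemma K_cross_nonneg: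
  assumes f: "f \<in> class_F0" and D: "mono_on {0<..<1} D"
    and D2: "set_integrable lborel {0<..<1} (\<lambda>u. (D u)\<^sup>2)"
  shows "0 \<le> K_cross D f"
proof -
  define \<phi> where "\<phi> = (\<lambda>u. loc_score f (quantile (dist_fun f) u))"
  let ?I = "indicator {0<..<1} :: real \<Rightarrow> real"
  note D01 [measurable] = mono_on_Ioo_measurable[OF D]
  have L1: "set_integrable lborel {0<..<1} \<phi>" and L2: "set_integrable lborel {0<..<1} (\<lambda>u. (\<phi> u)\<^sup>2)"
    and zero: "(LINT u:{0<..<1}|lborel. \<phi> u) = 0"
    using score_integrable[OF f] score_square_integrable[OF f] score_integral_zero[OF f]
    by (simp_all add: \<phi>_def)
  have \<phi>01 [measurable]: "(\<lambda>u. ?I u * \<phi> u) \<in> borel_measurable borel"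
    using L1 by (auto simp: set_integrable_def dest: borel_measurable_integrable)
  have intI: "integrable lborel (\<lambda>u. ?I u * \<phi> u)"
    using L1 by (simp add: set_integrable_def)
  \<comment> \<open>Clipping bounds the range of levels, so the double integral below is dominated
    by 2 n |\<phi>| and Fubini applies.\<close>
  define c where "c n x = max (- real n) (min (real n) x)" for n :: nat and x :: real
  have nonneg: "0 \<le> (LINT u:{0<..<1}|lborel. c n (D u) * \<phi> u)" for n
  proof -
    \<comment> \<open>Integrating over s first returns the clipped, shifted score times \<phi>;
      integrating over u first returns the integral of \<phi> over the set where D > s.\<close>
    define P where "P u s = (indicator {- real n..real n} s * (if s < ?I u * D u then 1 else 0)) * (?I u * \<phi> u)"
      for u s :: real
    have Pm [measurable]: "case_prod P \<in> borel_measurable (lborel \<Otimes>\<^sub>M lborel)"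
      unfolding P_def by measurable
    have layer: "(LINT s|lborel. P u s) = (c n (D u) + real n) * (?I u * \<phi> u)" for u
      unfolding P_def using integral_layer[of "real n" "?I u * D u"]
      by (cases "u \<in> {0<..<1}") (simp_all add: c_def)
    have Pint: "integrable (lborel \<Otimes>\<^sub>M lborel) (case_prod P)"
    proof (rule lborel_pair.Fubini_integrable)
      show "integrable lborel (\<lambda>u. LINT s|lborel. norm (case_prod P (u, s)))"
      proof (rule Bochner_Integration.integrable_bound)
        show "integrable lborel (\<lambda>u. (2 * real n) * (?I u * \<phi> u))"
          using intI by simp
        show "AE u in lborel. norm (LINT s|lborel. norm (case_prod P (u, s))) \<le> norm ((2 * real n) * (?I u * \<phi> u))"
        proof (rule AE_I2)
          fix u
          have "(LINT s|lborel. norm (case_prod P (u, s))) \<le> (LINT s|lborel. indicator {- real n..real n} s * \<bar>?I u * \<phi> u\<bar>)"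
            by (rule integral_mono_AE'[OF integrable_mult_left]) (simp, auto simp: P_def indicator_def abs_mult intro!: AE_I2)
          then show "norm (LINT s|lborel. norm (case_prod P (u, s))) \<le> norm ((2 * real n) * (?I u * \<phi> u))"
            by (simp add: abs_mult)
        qed
      qed measurable
      show "AE u in lborel. integrable lborel (\<lambda>s. case_prod P (u, s))"
      proof (rule AE_I2)
        fix u
        show "integrable lborel (\<lambda>s. case_prod P (u, s))"
        proof (rule Bochner_Integration.integrable_bound)
          show "integrable lborel (\<lambda>s. indicator {- real n..real n} s * \<bar>?I u * \<phi> u\<bar>)" by simp
        qed (simp add: P_def, auto simp: P_def indicator_def intro!: AE_I2)
      qed
    qed simp
    have "0 \<le> (LINT s|lborel. LINT u|lborel. P u s)"
    proof (rule integral_nonneg_AE, rule AE_I2)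
      fix s
      have "(LINT u|lborel. P u s) = indicator {- real n..real n} s *
          (LINT u:{0<..<1}|lborel. if s < D u then \<phi> u else 0)"
        unfolding set_lebesgue_integral_def P_def
        by (subst integral_mult_right_zero[symmetric]) (rule Bochner_Integration.integral_cong, auto simp: indicator_def)
      then show "0 \<le> (LINT u|lborel. P u s)"
        using score_upper_level_nonneg[OF f D, of s] unfolding \<phi>_def by simp
    qed
    also have "(LINT s|lborel. LINT u|lborel. P u s) = (LINT u|lborel. LINT s|lborel. P u s)"
      by (rule lborel_pair.Fubini_integral[OF Pint])
    also have "\<dots> = (LINT u:{0<..<1}|lborel. c n (D u) * \<phi> u + real n * \<phi> u)"
      unfolding layer set_lebesgue_integral_def by (simp add: algebra_simps)
    also have "\<dots> = (LINT u:{0<..<1}|lborel. c n (D u) * \<phi> u) + (LINT u:{0<..<1}|lborel. real n * \<phi> u)"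
    proof (rule set_integral_add(2))
      show "set_integrable lborel {0<..<1} (\<lambda>u. c n (D u) * \<phi> u)"
      proof (rule set_integrable_bound)
        show "set_integrable lborel {0<..<1} (\<lambda>u. real n * \<phi> u)" using L1 by auto
        have "(\<lambda>u. ?I u *\<^sub>R (c n (D u) * \<phi> u)) = (\<lambda>u. c n (?I u * D u) * (?I u * \<phi> u))"
          by (auto simp: indicator_def)
        then show "set_borel_measurable lborel {0<..<1} (\<lambda>u. c n (D u) * \<phi> u)"
          by (simp add: set_borel_measurable_def c_def)
        have "\<bar>c n x\<bar> \<le> real n" for x by (auto simp: c_def abs_if)
        then show "AE u in lborel. u \<in> {0<..<1} \<longrightarrow> norm (c n (D u) * \<phi> u) \<le> norm (real n * \<phi> u)"
          by (auto simp: abs_mult intro!: AE_I2 mult_right_mono)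
      qed
    qed (use L1 in auto)
    \<comment> \<open>The shift by n disappears because the score has mean 0.\<close>
    also have "(LINT u:{0<..<1}|lborel. real n * \<phi> u) = 0" by (simp add: zero)
    finally show ?thesis by simp
  qed
  \<comment> \<open>The clipping is removed by dominated convergence with bound |D \<phi>|,
    integrable since both factors are square-integrable.\<close>
  have "(\<lambda>n. LINT u:{0<..<1}|lborel. c n (D u) * \<phi> u) \<longlonglongrightarrow> (LINT u:{0<..<1}|lborel. D u * \<phi> u)"
    unfolding set_lebesgue_integral_def
  proof (rule integral_dominated_convergence)
    show "integrable lborel (\<lambda>u. ?I u *\<^sub>R \<bar>D u * \<phi> u\<bar>)"
      using set_integrable_abs[OF integrable_mult_square_integrable[OF D01 \<phi>01 D2 L2]]
      by (simp add: set_integrable_def)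
    show "AE u in lborel. (\<lambda>n. ?I u *\<^sub>R (c n (D u) * \<phi> u)) \<longlonglongrightarrow> ?I u *\<^sub>R (D u * \<phi> u)"
    proof (rule AE_I2)
      fix u
      have "(\<lambda>n. c n (D u)) \<longlonglongrightarrow> D u"
      proof (rule Lim_transform_eventually[OF tendsto_const])
        obtain N where "\<bar>D u\<bar> \<le> real N" using real_arch_simple by blast
        then show "\<forall>\<^sub>F n in sequentially. D u = c n (D u)"
          by (intro eventually_sequentiallyI[of N]) (auto simp: c_def)
      qed
      then show "(\<lambda>n. ?I u *\<^sub>R (c n (D u) * \<phi> u)) \<longlonglongrightarrow> ?I u *\<^sub>R (D u * \<phi> u)"
        by (intro tendsto_intros)
    qed
    have "\<bar>c n x\<bar> \<le> \<bar>x\<bar>" for n x by (auto simp: c_def abs_if)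
    then show "AE u in lborel. norm (?I u *\<^sub>R (c n (D u) * \<phi> u)) \<le> ?I u *\<^sub>R \<bar>D u * \<phi> u\<bar>" for n
      by (auto simp: abs_mult indicator_def intro!: AE_I2 mult_right_mono)
    have "(\<lambda>u. ?I u *\<^sub>R (c n (D u) * \<phi> u)) = (\<lambda>u. c n (?I u * D u) * (?I u * \<phi> u))" for n
      by (auto simp: indicator_def)
    then show "(\<lambda>u. ?I u *\<^sub>R (c n (D u) * \<phi> u)) \<in> borel_measurable lborel" for n
      by (simp add: c_def)
    have "(\<lambda>u. ?I u *\<^sub>R (D u * \<phi> u)) = (\<lambda>u. (?I u * D u) * (?I u * \<phi> u))"
      by (auto simp: indicator_def)
    then show "(\<lambda>u. ?I u *\<^sub>R (D u * \<phi> u)) \<in> borel_measurable lborel"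
      by simp
  qed
  then have "0 \<le> (LINT u:{0<..<1}|lborel. D u * \<phi> u)"
    by (rule LIMSEQ_le_const) (use nonneg in auto)
  then show ?thesis by (simp add: K_cross_def \<phi>_def)
qed

subsection \<open>Student and normal scores\<close>

text \<open>Substitution \<open>t = x\<^sup>2 / (\<nu> + x\<^sup>2)\<close> in the Beta integral. For \<open>b = 1 / 2\<close> the integrand is 0 instead
  of 1 at the origin, because \<open>0 powr 0 = 0\<close>.\<close>

lemma has_bochner_integral_student_moment:
  fixes a b \<nu> :: real
  assumes "a > 0" "b > 0" "\<nu> > 0"
  shows "has_bochner_integral lborel (\<lambda>x. (x\<^sup>2 / \<nu>) powr (b - 1 / 2) * (1 + x\<^sup>2 / \<nu>) powr - (a + b))
           (sqrt \<nu> * Beta b a)"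
proof -
  let ?S = "{0<..} :: real set"
  define f where "f t = t powr (b - 1) * (1 - t) powr (a - 1)" for t :: real
  define g where "g x = x\<^sup>2 / (\<nu> + x\<^sup>2)" for x :: real
  define g' where "g' x = 2 * \<nu> * x / (\<nu> + x\<^sup>2)\<^sup>2" for x :: real
  define h where "h x = (x\<^sup>2 / \<nu>) powr (b - 1 / 2) * (1 + x\<^sup>2 / \<nu>) powr - (a + b)" for x :: real
  have pos: "\<nu> + x\<^sup>2 > 0" for x using \<open>\<nu> > 0\<close> by (simp add: add_pos_nonneg)
  have f01: "(f has_integral Beta b a) {0<..<1}"
    using has_integral_Beta_real[OF \<open>b > 0\<close> \<open>a > 0\<close>] by (simp add: f_def[abs_def] has_integral_Icc_iff_Ioo)
  have g: "(g has_field_derivative g' x) (at x within ?S)" for x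
    unfolding g_def g'_def using pos[of x]
    by (auto intro!: derivative_eq_intros simp: power2_eq_square field_simps)
  have inj: "inj_on g ?S"
  proof (rule inj_onI)
    fix x y assume "x \<in> ?S" "y \<in> ?S" "g x = g y"
    then have "x\<^sup>2 * (\<nu> + y\<^sup>2) = y\<^sup>2 * (\<nu> + x\<^sup>2)"
      using pos[of x] pos[of y] by (simp add: g_def frac_eq_eq)
    then have "x\<^sup>2 = y\<^sup>2" using \<open>\<nu> > 0\<close> by (simp add: algebra_simps)
    then show "x = y" using \<open>x \<in> ?S\<close> \<open>y \<in> ?S\<close> by (simp add: power2_eq_iff)
  qed
  have img: "g ` ?S = {0<..<1}"
  proof (intro equalityI subsetI)
    fix t assume "t \<in> g ` ?S"
    then show "t \<in> {0<..<1}" using pos \<open>\<nu> > 0\<close> by (auto simp: g_def field_simps)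
  next
    fix t :: real assume t: "t \<in> {0<..<1}"
    have "g (sqrt (\<nu> * t / (1 - t))) = t"
      using t \<open>\<nu> > 0\<close> by (simp add: g_def field_simps)
    then show "t \<in> g ` ?S"
      using t \<open>\<nu> > 0\<close> by (intro image_eqI[where x="sqrt (\<nu> * t / (1 - t))"]) auto
  qed
  have "f absolutely_integrable_on g ` ?S \<and> integral (g ` ?S) f = Beta b a"
    unfolding img using f01 by (auto intro!: nonnegative_absolutely_integrable_1 simp: f_def)
  then have ai: "(\<lambda>x. \<bar>g' x\<bar> * f (g x)) absolutely_integrable_on ?S" 
    and int: "integral ?S (\<lambda>x. \<bar>g' x\<bar> * f (g x)) = Beta b a"
    using has_absolute_integral_change_of_variables_1'[OF _ g inj, of f "Beta b a"] by auto
  have eq: "\<bar>g' x\<bar> * f (g x) = 2 / sqrt \<nu> * h x" if "x > 0" for x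
  proof -
    \<comment> \<open>In these variables g x = s / p and 1 - g x = 1 / p, so only powers of s and p
      remain. The exponents add up to 1/2 + (b - 1) and -2 + (1 - b) + (1 - a).\<close>
    define p where "p = 1 + x\<^sup>2 / \<nu>"
    define s where "s = x\<^sup>2 / \<nu>"
    have "s > 0" "p > 0" using that \<open>\<nu> > 0\<close> by (auto simp: s_def p_def add_pos_pos)
    have gs: "g x = s / p" using \<open>\<nu> > 0\<close> by (simp add: g_def s_def p_def field_simps)
    have gp: "1 - g x = 1 / p" using \<open>\<nu> > 0\<close> pos[of x] by (simp add: g_def p_def field_simps)
    have "sqrt s = x / sqrt \<nu>" using that by (simp add: s_def real_sqrt_divide)
    then have x_eq: "x = sqrt \<nu> * s powr (1 / 2)" using \<open>\<nu> > 0\<close> \<open>s > 0\<close> by (simp add: powr_half_sqrt)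
    have pp: "\<nu> + x\<^sup>2 = \<nu> * p" using \<open>\<nu> > 0\<close> by (simp add: p_def field_simps)
    have "\<bar>g' x\<bar> = 2 * x / \<nu> * (1 / p\<^sup>2)"
      using that \<open>\<nu> > 0\<close> \<open>p > 0\<close> unfolding g'_def pp by (simp add: power2_eq_square field_simps)
    also have "2 * x / \<nu> = 2 / sqrt \<nu> * s powr (1 / 2)"
    proof -
      have "2 * x / \<nu> = 2 * (sqrt \<nu> * s powr (1 / 2)) / (sqrt \<nu> * sqrt \<nu>)" using \<open>\<nu> > 0\<close> by (subst x_eq) simp
      also have "\<dots> = 2 / sqrt \<nu> * s powr (1 / 2)" using \<open>\<nu> > 0\<close> by (simp del: real_sqrt_mult_self)
      finally show ?thesis .
    qed
    also have "1 / p\<^sup>2 = p powr (-2)"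
      using \<open>p > 0\<close> by (simp add: powr_minus_divide powr_numeral)
    finally have g'p: "\<bar>g' x\<bar> = 2 / sqrt \<nu> * s powr (1 / 2) * p powr (-2)" .
    have "f (g x) = (s powr (b - 1) * p powr (1 - b)) * p powr (1 - a)"
    proof -
      have "(s / p) powr (b - 1) = s powr (b - 1) * p powr (1 - b)"
        using \<open>s > 0\<close> \<open>p > 0\<close> powr_minus_divide[of p "b - 1"] by (simp add: powr_divide)
      moreover have "(1 / p) powr (a - 1) = p powr (1 - a)"
        using \<open>p > 0\<close> powr_minus_divide[of p "a - 1"] by (simp add: powr_divide)
      ultimately show ?thesis by (simp add: f_def gp) (simp add: gs)
    qed
    then have "\<bar>g' x\<bar> * f (g x) = 2 / sqrt \<nu> * ((s powr (1 / 2) * s powr (b - 1)) * (p powr (-2) * p powr (1 - b) * p powr (1 - a)))"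
      by (simp add: g'p)
    also have "\<dots> = 2 / sqrt \<nu> * (s powr (b - 1 / 2) * p powr - (a + b))"
      by (simp add: powr_add[symmetric] algebra_simps)
    finally show ?thesis by (simp add: h_def s_def p_def)
  qed
  have [measurable]: "h \<in> borel_measurable borel" unfolding h_def by measurable
  have "(\<lambda>x. 2 / sqrt \<nu> * h x) absolutely_integrable_on ?S"
    by (rule set_integrable_cong[THEN iffD1, OF refl refl _ ai]) (use eq in simp)
  then have "(\<lambda>x. sqrt \<nu> / 2 * (2 / sqrt \<nu> * h x)) absolutely_integrable_on ?S" 
    by (rule set_integrable_mult_right)
  then have hS: "h absolutely_integrable_on ?S" using \<open>\<nu> > 0\<close> by (simp add: field_simps)
  have "Beta b a = integral ?S (\<lambda>x. 2 / sqrt \<nu> * h x)"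
    unfolding int[symmetric] by (rule Henstock_Kurzweil_Integration.integral_cong) (use eq in simp)
  then have "integral ?S h = sqrt \<nu> / 2 * Beta b a" using \<open>\<nu> > 0\<close> by simp
  moreover have "integral ?S h = (LINT x|lebesgue. indicator ?S x *\<^sub>R h x)"
    using set_lebesgue_integral_eq_integral(2)[OF hS] by (simp add: set_lebesgue_integral_def)
  moreover have "\<dots> = (LINT x|lborel. indicator ?S x *\<^sub>R h x)"
    by (rule integral_completion) measurable
  moreover have "integrable lborel (\<lambda>x. indicator ?S x *\<^sub>R h x)"
    using hS unfolding set_integrable_def by (subst (asm) integrable_completion) auto
  ultimately have "has_bochner_integral lborel (\<lambda>x. indicator ?S x *\<^sub>R h x) (sqrt \<nu> / 2 * Beta b a)"
    by (simp add: has_bochner_integral_iff)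
  \<comment> \<open>For every b the convention \<open>0 powr y = 0\<close> makes h vanish at 0, so
    the half-line may be closed before the even reflection doubles the integral.\<close>
  also have "(\<lambda>x. indicator ?S x *\<^sub>R h x) = (\<lambda>x. indicator {0..} x *\<^sub>R h x)"
    by (auto simp: indicator_def h_def fun_eq_iff)
  finally have "has_bochner_integral lborel h (2 *\<^sub>R (sqrt \<nu> / 2 * Beta b a))"
    by (rule has_bochner_integral_even_function) (simp add: h_def)
  then show ?thesis by (simp add: h_def[abs_def])
qed

text \<open>This is the value of the density at its mode 0, which determines the constant in the
  Lipschitz bound below.\<close>

definition student_const :: "real \<Rightarrow> real" where
  "student_const \<nu> = Gamma ((\<nu> + 1) / 2) / (sqrt (\<nu> * pi) * Gamma (\<nu> / 2))"

lemma student_density_eq: "student_density \<nu> x = student_const \<nu> * (1 + x\<^sup>2 / \<nu>) powr (- (\<nu> + 1) / 2)"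
  by (simp add: student_density_def student_const_def)

lemma student_const_pos: "\<nu> > 0 \<Longrightarrow> student_const \<nu> > 0"
  by (auto simp: student_const_def intro!: divide_pos_pos mult_pos_pos)

lemma student_const_normalizes:
  assumes "\<nu> > 0"
  shows "student_const \<nu> * (sqrt \<nu> * Beta (1 / 2) (\<nu> / 2)) = 1"
proof -
  have "Gamma (\<nu> / 2) > 0" "Gamma ((\<nu> + 1) / 2) > 0" using assms by auto
  then have "Gamma (\<nu> / 2) \<noteq> 0" "Gamma ((\<nu> + 1) / 2) \<noteq> 0" by auto
  moreover have eq: "1 / 2 + \<nu> / 2 = (\<nu> + 1) / 2" by (simp add: field_simps)
  ultimately show ?thesis
    unfolding student_const_def Beta_def eq Gamma_one_half_real real_sqrt_mult using assms by simp
qed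

lemma prob_density_student:
  assumes "\<nu> > 0"
  shows "prob_density (student_density \<nu>)"
proof -
  have meas: "student_density \<nu> \<in> borel_measurable borel"
    unfolding student_density_eq[abs_def] by measurable
  have *: "has_bochner_integral lborel (\<lambda>x. (x\<^sup>2 / \<nu>) powr (1 / 2 - 1 / 2) * (1 + x\<^sup>2 / \<nu>) powr - (\<nu> / 2 + 1 / 2))
           (sqrt \<nu> * Beta (1 / 2) (\<nu> / 2))"
    using assms by (intro has_bochner_integral_student_moment) auto
  have "has_bochner_integral lborel (student_density \<nu>) (student_const \<nu> * (sqrt \<nu> * Beta (1 / 2) (\<nu> / 2)))"
  proof (rule has_bochner_integralI_AE[OF has_bochner_integral_mult_right[OF *]])
    \<comment> \<open>At the origin the moment integrand contains \<open>0 powr 0 = 0\<close> and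
      differs from the density.\<close>
    have "AE x in lborel. x \<noteq> (0::real)" by (rule AE_lborel_singleton)
    then show "AE x in lborel. student_const \<nu> * ((x\<^sup>2 / \<nu>) powr (1 / 2 - 1 / 2) * (1 + x\<^sup>2 / \<nu>) powr - (\<nu> / 2 + 1 / 2)) = student_density \<nu> x"
    proof eventually_elim
      case (elim x)
      have "- (\<nu> / 2 + 1 / 2) = - (\<nu> + 1) / 2" by (simp add: field_simps)
      then show ?case using elim assms by (simp only: student_density_eq) simp
    qed
  qed (use meas in simp)
  moreover have "0 \<le> student_density \<nu> x" for x
    using student_const_pos[OF assms] by (simp add: student_density_eq)
  ultimately show ?thesis
    using student_const_normalizes[OF assms] by (simp add: prob_density_def has_bochner_integral_iff)
qed

lemma prob_density_std_normal: "prob_density std_normal_density"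
  by (simp add: prob_density_def)

lemma dist_fun_diff:
  assumes f: "prob_density f" and "x \<le> y"
  shows "dist_fun f y - dist_fun f x = (LINT t:{x..y}|lborel. f t)"
proof (cases "x = y")
  case True
  have "AE t in lborel. t \<noteq> y" by (rule AE_lborel_singleton)
  then have "AE t in lborel. indicator {x..y} t *\<^sub>R f t = 0"
    by eventually_elim (use True in \<open>auto simp: indicator_def\<close>)
  then have "(LINT t:{x..y}|lborel. f t) = 0"
    unfolding set_lebesgue_integral_def by (rule integral_eq_zero_AE)
  then show ?thesis using True by simp
next
  case False
  then have "x < y" using assms by simp
  let ?M = "density lborel (\<lambda>x. ennreal (f x))"
  interpret cdf_distribution ?M by (rule cdf_distribution_prob_density[OF f])
  note [measurable] = prob_density_measurable[OF f]
  have nn: "AE x in lborel. 0 \<le> f x" using f by (simp add: prob_density_def)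
  have "dist_fun f y - dist_fun f x = measure ?M {x<..y}"
    unfolding dist_fun_def by (rule cdf_diff_eq[OF \<open>x < y\<close>])
  also have "\<dots> = (LINT t|?M. indicator {x<..y} t)" by simp
  also have "\<dots> = (LINT t|lborel. f t * indicator {x<..y} t)"
    by (rule integral_real_density) (use nn in auto)
  also have "\<dots> = (LINT t:{x..y}|lborel. f t)"
    unfolding set_lebesgue_integral_def
  proof (rule integral_cong_AE)
    have "AE t in lborel. t \<noteq> x" by (rule AE_lborel_singleton)
    then show "AE t in lborel. f t * indicator {x<..y} t = indicator {x..y} t *\<^sub>R f t"
      by eventually_elim (auto simp: indicator_def)
  qed auto
  finally show ?thesis .
qed

lemma prob_density_set_integrable: "prob_density f \<Longrightarrow> A \<in> sets borel \<Longrightarrow> set_integrable lborel A f"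
  by (rule set_integrable_subset[where A=UNIV]) (auto simp: prob_density_def set_integrable_def)

section \<open>Comparison of score increments\<close>

text \<open>Integrating a pointwise comparison of \<open>G'\<close> with the density compares the
  increments of \<open>G\<close> and of the distribution function. Evaluated at quantiles, this
  bounds score increments by increments of u, or the reverse.\<close>

lemma dist_fun_diff_mono:
  fixes G G' :: "real \<Rightarrow> real"
  assumes f: "prob_density f" and "x \<le> y"
    and G: "\<And>t. (G has_real_derivative G' t) (at t)" and cont: "continuous_on UNIV G'"
  shows "(\<And>t. \<bar>G' t\<bar> \<le> C * f t) \<Longrightarrow> \<bar>G y - G x\<bar> \<le> C * (dist_fun f y - dist_fun f x)"
    and "(\<And>t. f t \<le> G' t) \<Longrightarrow> dist_fun f y - dist_fun f x \<le> G y - G x"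
proof -
  have int: "set_integrable lborel {x..y} G'"
    by (rule borel_integrable_atLeastAtMost'[OF continuous_on_subset[OF cont]]) simp
  note fint = prob_density_set_integrable[OF f, of "{x..y}", simplified]
  have "(LBINT t=ereal x..ereal y. G' t) = G y - G x"
    by (rule interval_integral_FTC_finite)
       (auto intro!: continuous_on_subset[OF cont] has_field_derivative_at_within G
         simp: has_real_derivative_iff_has_vector_derivative[symmetric])
  then have FTC: "G y - G x = (LINT t:{x..y}|lborel. G' t)"
    using \<open>x \<le> y\<close> by (simp add: interval_integral_Icc)
  show "\<bar>G y - G x\<bar> \<le> C * (dist_fun f y - dist_fun f x)" if "\<And>t. \<bar>G' t\<bar> \<le> C * f t"
  proof -
    have "\<bar>G y - G x\<bar> \<le> (LINT t:{x..y}|lborel. \<bar>G' t\<bar>)"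
      unfolding FTC using set_integral_norm_bound[OF int] by simp
    also have "\<dots> \<le> (LINT t:{x..y}|lborel. C * f t)"
      by (rule set_integral_mono) (use that int fint in \<open>auto intro: set_integrable_abs\<close>)
    also have "\<dots> = C * (dist_fun f y - dist_fun f x)"
      by (simp add: dist_fun_diff[OF f \<open>x \<le> y\<close>])
    finally show ?thesis .
  qed
  show "dist_fun f y - dist_fun f x \<le> G y - G x" if "\<And>t. f t \<le> G' t"
    unfolding FTC dist_fun_diff[OF f \<open>x \<le> y\<close>]
    by (rule set_integral_mono) (use that int fint in auto)
qed

text \<open>This is -f'/f for the Student density f.\<close>

definition student_score :: "real \<Rightarrow> real \<Rightarrow> real" where
  "student_score \<nu> x = (\<nu> + 1) * x / (\<nu> + x\<^sup>2)"

lemma J_t_eq: "J_t \<nu> = (\<lambda>u. student_score \<nu> (quantile (dist_fun (student_density \<nu>)) u))"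
  by (simp add: J_t_def student_score_def Let_def fun_eq_iff)

text \<open>With p = 1 + t^2 / \<nu>, replacing |\<nu> - t^2| by \<nu> + t^2 bounds the derivative
  of the score by (\<nu> + 1)/\<nu> times 1/p, and the density is a multiple of p to the power
  -(\<nu> + 1)/2. All these estimates are equalities at t = 0, so the constant is sharp.\<close>

lemma student_score_lipschitz:
  assumes "0 < \<nu>" "\<nu> \<le> 1" "x \<le> y"
  shows "\<bar>student_score \<nu> y - student_score \<nu> x\<bar> \<le> (\<nu> + 1) / (student_const \<nu> * \<nu>) *
    (dist_fun (student_density \<nu>) y - dist_fun (student_density \<nu>) x)"
proof (rule dist_fun_diff_mono(1)[OF prob_density_student[OF assms(1)] assms(3)])
  define G' where "G' t = (\<nu> + 1) * (\<nu> - t\<^sup>2) / (\<nu> + t\<^sup>2)\<^sup>2" for t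
  have pos: "\<nu> + t\<^sup>2 > 0" for t using assms by (simp add: add_pos_nonneg)
  show "(student_score \<nu> has_real_derivative G' t) (at t)" for t
    unfolding student_score_def G'_def using pos[of t]
    by (auto intro!: derivative_eq_intros simp: power2_eq_square field_simps)
  show "continuous_on UNIV G'"
    unfolding G'_def using pos by (intro continuous_intros) (auto simp: less_imp_neq[THEN not_sym])
  show "\<bar>G' t\<bar> \<le> (\<nu> + 1) / (student_const \<nu> * \<nu>) * student_density \<nu> t" for t
  proof -
    define p where "p = 1 + t\<^sup>2 / \<nu>"
    have p: "p \<ge> 1" using assms by (simp add: p_def)
    have pp: "\<nu> + t\<^sup>2 = \<nu> * p" using assms by (simp add: p_def field_simps)
    have "\<bar>G' t\<bar> = (\<nu> + 1) * \<bar>\<nu> - t\<^sup>2\<bar> / (\<nu> + t\<^sup>2)\<^sup>2"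
      using assms by (simp add: G'_def abs_mult)
    also have "\<dots> \<le> (\<nu> + 1) * (\<nu> + t\<^sup>2) / (\<nu> + t\<^sup>2)\<^sup>2"
    proof (intro divide_right_mono mult_left_mono)
      show "\<bar>\<nu> - t\<^sup>2\<bar> \<le> \<nu> + t\<^sup>2"
        by (rule abs_leI) (use assms zero_le_power2[of t] in linarith)+
    qed (use assms in auto)
    also have "\<dots> = (\<nu> + 1) / \<nu> * p powr (-1)"
      unfolding pp using assms p by (simp add: power2_eq_square powr_minus_divide)
    \<comment> \<open>Here \<nu> \<le> 1 enters: the exponent -1 is at most -(\<nu> + 1)/2, and p
      \<ge> 1.\<close>
    also have "\<dots> \<le> (\<nu> + 1) / \<nu> * p powr (- (\<nu> + 1) / 2)"
      using assms p by (intro mult_left_mono powr_mono) auto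
    also have "\<dots> = (\<nu> + 1) / (student_const \<nu> * \<nu>) * student_density \<nu> t"
      using student_const_pos[OF assms(1)] by (simp add: student_density_eq p_def)
    finally show ?thesis .
  qed
qed

lemma J_t_lipschitz:
  assumes "0 < \<nu>" "\<nu> \<le> 1" "0 < r" "r \<le> s" "s < 1"
  shows "\<bar>J_t \<nu> s - J_t \<nu> r\<bar> \<le> (\<nu> + 1) / (student_const \<nu> * \<nu>) * (s - r)"
proof -
  note t = prob_density_student[OF assms(1)]
  let ?Q = "quantile (dist_fun (student_density \<nu>))"
  have "?Q r \<le> ?Q s" using mono_onD[OF mono_on_quantile[OF t], of r s] assms by auto
  from student_score_lipschitz[OF assms(1,2) this] show ?thesis
    using assms by (simp add: J_t_eq dist_fun_quantile[OF t])
qed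

text \<open>The normal density is at most its value 1 / sqrt (2 * pi) at 0, so the distribution
  function contracts by at least this factor and its inverse expands accordingly.\<close>

lemma J_vdW_expanding:
  assumes "0 < r" "r \<le> s" "s < 1"
  shows "s - r \<le> (J_vdW s - J_vdW r) / sqrt (2 * pi)"
proof -
  note n = prob_density_std_normal
  let ?Q = "quantile (dist_fun std_normal_density)"
  have "?Q r \<le> ?Q s" using mono_onD[OF mono_on_quantile[OF n], of r s] assms by auto
  then have "dist_fun std_normal_density (?Q s) - dist_fun std_normal_density (?Q r) \<le> ?Q s / sqrt (2 * pi) - ?Q r / sqrt (2 * pi)"
  proof (rule dist_fun_diff_mono(2)[OF n])
    show "((\<lambda>t. t / sqrt (2 * pi)) has_real_derivative 1 / sqrt (2 * pi)) (at t)" for t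
      by (rule DERIV_cdivide[OF DERIV_ident])
    show "std_normal_density t \<le> 1 / sqrt (2 * pi)" for t
      by (simp add: std_normal_density_def divide_right_mono)
  qed auto
  then show ?thesis
    using assms by (simp add: dist_fun_quantile[OF n] J_vdW_def diff_divide_distrib)
qed

section \<open>Squared norms of the three scores\<close>

lemma K_score_W: "set_integrable lborel {0<..<1} (\<lambda>u. (J_W u)\<^sup>2)" "K_score J_W = 1 / 12"
proof -
  have "set_integrable lborel {0..1} (\<lambda>u. (J_W u)\<^sup>2)"
    unfolding J_W_def by (intro borel_integrable_atLeastAtMost' continuous_intros)
  then show "set_integrable lborel {0<..<1} (\<lambda>u. (J_W u)\<^sup>2)"
    by (rule set_integrable_subset) auto
  have "(LBINT u=ereal 0..ereal 1. (J_W u)\<^sup>2) = (1 - 1 / 2) ^ 3 / 3 - (0 - 1 / 2 :: real) ^ 3 / 3"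
    by (rule interval_integral_FTC_finite)
       (auto intro!: continuous_intros derivative_eq_intros
         simp: J_W_def has_real_derivative_iff_has_vector_derivative[symmetric] power2_eq_square)
  moreover have "(LBINT u=ereal 0..ereal 1. (J_W u)\<^sup>2) = (LINT u:{0<..<1}|lborel. (J_W u)\<^sup>2)"
    by (subst interval_integral_Ioo) auto
  ultimately show "K_score J_W = 1 / 12"
    by (simp add: K_score_def power3_eq_cube)
qed

lemma K_score_vdW: "set_integrable lborel {0<..<1} (\<lambda>u. (J_vdW u)\<^sup>2)" "K_score J_vdW = 1"
  using quantile_transform[OF prob_density_std_normal, of "\<lambda>x. x\<^sup>2"] std_normal_moment_even[of 1]
  by (simp_all add: J_vdW_def K_score_def has_bochner_integral_iff)

text \<open>The quantile transform turns this into the Fisher information of the Student density,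
  which is the moment above with b = 3/2 and a = \<nu>/2 + 1.\<close>

lemma K_score_t:
  assumes "\<nu> > 0"
  shows "set_integrable lborel {0<..<1} (\<lambda>u. (J_t \<nu> u)\<^sup>2)" "K_score (J_t \<nu>) = (\<nu> + 1) / (\<nu> + 3)"
proof -
  let ?B = "sqrt \<nu> * Beta (3 / 2) (\<nu> / 2 + 1)"
  define c where "c = student_const \<nu> * ((\<nu> + 1)\<^sup>2 / \<nu>)"
  have "has_bochner_integral lborel (\<lambda>x. c * ((x\<^sup>2 / \<nu>) powr (3 / 2 - 1 / 2) * (1 + x\<^sup>2 / \<nu>) powr - ((\<nu> / 2 + 1) + 3 / 2))) (c * ?B)"
    using assms by (intro has_bochner_integral_mult_right has_bochner_integral_student_moment) auto
  also have "(\<lambda>x. c * ((x\<^sup>2 / \<nu>) powr (3 / 2 - 1 / 2) * (1 + x\<^sup>2 / \<nu>) powr - ((\<nu> / 2 + 1) + 3 / 2)))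
      = (\<lambda>x. student_density \<nu> x * (student_score \<nu> x)\<^sup>2)"
  proof
    fix x
    define p where "p = 1 + x\<^sup>2 / \<nu>"
    have "p > 0" using assms by (simp add: p_def add_pos_nonneg)
    have pp: "\<nu> + x\<^sup>2 = \<nu> * p" using assms by (simp add: p_def field_simps)
    have "p powr - ((\<nu> / 2 + 1) + 3 / 2) = p powr (- (\<nu> + 1) / 2) * p powr (-2)"
    proof -
      have "- ((\<nu> / 2 + 1) + 3 / 2) = - (\<nu> + 1) / 2 + (-2)" by (simp add: field_simps)
      then show ?thesis by (simp only: powr_add)
    qed
    also have "p powr (-2) = 1 / p\<^sup>2"
      using \<open>p > 0\<close> by (simp add: powr_minus_divide powr_numeral)
    finally have e: "p powr - ((\<nu> / 2 + 1) + 3 / 2) = p powr (- (\<nu> + 1) / 2) * (1 / p\<^sup>2)" .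
    have "(student_score \<nu> x)\<^sup>2 = (\<nu> + 1)\<^sup>2 * x\<^sup>2 / (\<nu>\<^sup>2 * p\<^sup>2)"
      unfolding student_score_def pp by (simp add: power_divide power_mult_distrib)
    then show "c * ((x\<^sup>2 / \<nu>) powr (3 / 2 - 1 / 2) * (1 + x\<^sup>2 / \<nu>) powr - ((\<nu> / 2 + 1) + 3 / 2))
        = student_density \<nu> x * (student_score \<nu> x)\<^sup>2"
      unfolding student_density_eq p_def[symmetric] e using assms
      by (simp add: c_def power2_eq_square mult_ac)
  qed
  finally have *: "has_bochner_integral lborel (\<lambda>x. student_density \<nu> x * (student_score \<nu> x)\<^sup>2) (c * ?B)" .
  have [measurable]: "student_score \<nu> \<in> borel_measurable borel"
    unfolding student_score_def by measurable
  note tr = quantile_transform[OF prob_density_student[OF assms], of "\<lambda>x. (student_score \<nu> x)\<^sup>2"]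
  show "set_integrable lborel {0<..<1} (\<lambda>u. (J_t \<nu> u)\<^sup>2)"
    using tr(1) * by (simp add: J_t_eq has_bochner_integral_iff)
  have "K_score (J_t \<nu>) = c * ?B"
    using tr(2) * by (simp add: J_t_eq K_score_def has_bochner_integral_iff)
  \<comment> \<open>The Gamma recursion goes back to the Beta value of the normalization, which then
    cancels against \<open>student_const \<nu>\<close>.\<close>
  also have "?B = sqrt \<nu> * Beta (1 / 2) (\<nu> / 2) * (\<nu> / ((\<nu> + 3) * (\<nu> + 1)))"
  proof -
    have Gamma_step: "Gamma (x + 1) = x * Gamma x" if "x > 0" for x :: real
      using that by (intro Gamma_plus1) (auto dest: nonpos_Ints_nonpos)
    have [simp]: "Gamma (3 / 2 :: real) = 1 / 2 * Gamma (1 / 2)"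
      using Gamma_step[of "1 / 2"] by simp
    have [simp]: "Gamma (\<nu> / 2 + 1) = \<nu> / 2 * Gamma (\<nu> / 2)"
      using assms by (intro Gamma_step) auto
    have "Gamma (3 / 2 + (\<nu> / 2 + 1)) = (\<nu> + 3) / 2 * Gamma ((\<nu> + 3) / 2)"
      using Gamma_step[of "(\<nu> + 3) / 2"] assms by (simp add: field_simps)
    also have "Gamma ((\<nu> + 3) / 2) = (\<nu> + 1) / 2 * Gamma (1 / 2 + \<nu> / 2)"
      using Gamma_step[of "(\<nu> + 1) / 2"] assms by (simp add: field_simps)
    finally have eq: "Gamma (3 / 2 + (\<nu> / 2 + 1)) = (\<nu> + 3) / 2 * ((\<nu> + 1) / 2 * Gamma (1 / 2 + \<nu> / 2))" .
    show ?thesis unfolding Beta_def eq by (simp add: mult_ac)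
  qed
  also have "c * \<dots> = (student_const \<nu> * (sqrt \<nu> * Beta (1 / 2) (\<nu> / 2))) * ((\<nu> + 1)\<^sup>2 / \<nu> * (\<nu> / ((\<nu> + 3) * (\<nu> + 1))))"
    by (simp add: c_def)
  also have "\<dots> = (\<nu> + 1) / (\<nu> + 3)"
    unfolding student_const_normalizes[OF assms] using assms by (simp add: power2_eq_square)
  finally show "K_score (J_t \<nu>) = (\<nu> + 1) / (\<nu> + 3)" .
qed

section \<open>The efficiency bound\<close>

lemma ARE_le:
  assumes f: "f \<in> class_F0" and "C > 0"
    and lip: "\<And>r s. 0 < r \<Longrightarrow> r \<le> s \<Longrightarrow> s < 1 \<Longrightarrow> \<bar>J s - J r\<bar> \<le> C * (B s - B r)"
    and J2: "set_integrable lborel {0<..<1} (\<lambda>u. (J u)\<^sup>2)"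
    and B2: "set_integrable lborel {0<..<1} (\<lambda>u. (B u)\<^sup>2)"
    and K: "0 \<le> K_score B / K_score J"
  shows "ARE f J B \<le> K_score B / K_score J * C\<^sup>2"
proof -
  let ?I = "indicator {0<..<1} :: real \<Rightarrow> real"
  define \<phi> where "\<phi> = (\<lambda>u. loc_score f (quantile (dist_fun f) u))"
  \<comment> \<open>Only e = 0, 1 and -1 are used: the first gives the sign of
    \<open>K_cross B f\<close>, the other two the bound on \<open>K_cross J f\<close>.\<close>
  have mono: "mono_on {0<..<1} (\<lambda>u. C * B u + e * J u)" if "\<bar>e\<bar> \<le> 1" for e
  proof (rule mono_onI)
    fix r s :: real assume "r \<in> {0<..<1}" "s \<in> {0<..<1}" "r \<le> s"
    then have "\<bar>J s - J r\<bar> \<le> C * (B s - B r)" by (intro lip) auto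
    moreover have "\<bar>e * (J s - J r)\<bar> \<le> \<bar>J s - J r\<bar>"
      using that by (simp add: abs_mult mult_left_le_one_le)
    ultimately have "\<bar>e * (J s - J r)\<bar> \<le> C * (B s - B r)" by linarith
    then show "C * B r + e * J r \<le> C * B s + e * J s"
      by (simp add: algebra_simps abs_le_iff)
  qed
  \<comment> \<open>Measurability of \<open>B\<close> and \<open>J\<close> is read off from the
    monotone combinations with e = 0 and e = 1.\<close>
  have CB [measurable]: "(\<lambda>u. ?I u * (C * B u)) \<in> borel_measurable borel"
    using mono_on_Ioo_measurable[OF mono[of 0]] by simp
  have "(\<lambda>u. ?I u * (C * B u + J u)) \<in> borel_measurable borel"
    using mono_on_Ioo_measurable[OF mono[of 1]] by simp
  then have "(\<lambda>u. ?I u * (C * B u + J u) - ?I u * (C * B u)) \<in> borel_measurable borel"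
    by measurable
  then have Jm [measurable]: "(\<lambda>u. ?I u * J u) \<in> borel_measurable borel"
    by (simp add: algebra_simps)
  have "(\<lambda>u. (1 / C) * (?I u * (C * B u))) \<in> borel_measurable borel" by measurable
  then have Bm [measurable]: "(\<lambda>u. ?I u * B u) \<in> borel_measurable borel"
    using \<open>C > 0\<close> by simp
  have \<phi>2: "set_integrable lborel {0<..<1} (\<lambda>u. (\<phi> u)\<^sup>2)"
    using score_square_integrable[OF f] by (simp add: \<phi>_def)
  have \<phi>m: "(\<lambda>u. ?I u * \<phi> u) \<in> borel_measurable borel"
    using score_integrable[OF f] by (auto simp: \<phi>_def set_integrable_def dest: borel_measurable_integrable)
  have JB: "set_integrable lborel {0<..<1} (\<lambda>u. J u * B u)"
    by (rule integrable_mult_square_integrable[OF Jm Bm J2 B2])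
  have B\<phi>: "set_integrable lborel {0<..<1} (\<lambda>u. B u * \<phi> u)"
    by (rule integrable_mult_square_integrable[OF Bm \<phi>m B2 \<phi>2])
  have J\<phi>: "set_integrable lborel {0<..<1} (\<lambda>u. J u * \<phi> u)"
    by (rule integrable_mult_square_integrable[OF Jm \<phi>m J2 \<phi>2])
  have nonneg: "0 \<le> C * K_cross B f + e * K_cross J f" if "\<bar>e\<bar> \<le> 1" for e
  proof -
    have "set_integrable lborel {0<..<1} (\<lambda>u. C\<^sup>2 * (B u)\<^sup>2 + 2 * C * e * (J u * B u) + e\<^sup>2 * (J u)\<^sup>2)"
      using B2 J2 JB by (intro set_integral_add set_integrable_mult_right)
    then have "set_integrable lborel {0<..<1} (\<lambda>u. (C * B u + e * J u)\<^sup>2)"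
      by (simp add: power2_eq_square algebra_simps)
    from K_cross_nonneg[OF f mono[OF that] this]
    have "0 \<le> (LINT u:{0<..<1}|lborel. (C * B u + e * J u) * \<phi> u)"
      by (simp add: K_cross_def \<phi>_def)
    also have "\<dots> = (LINT u:{0<..<1}|lborel. C * (B u * \<phi> u) + e * (J u * \<phi> u))"
      by (simp add: algebra_simps)
    also have "\<dots> = (LINT u:{0<..<1}|lborel. C * (B u * \<phi> u)) + (LINT u:{0<..<1}|lborel. e * (J u * \<phi> u))"
      using B\<phi> J\<phi> by (intro set_integral_add set_integrable_mult_right)
    also have "\<dots> = C * K_cross B f + e * K_cross J f"
      by (simp add: K_cross_def \<phi>_def)
    finally show ?thesis .
  qed
  have le: "\<bar>K_cross J f\<bar> \<le> C * K_cross B f"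
    using nonneg[of 1] nonneg[of "-1"] by simp
  have "(K_cross J f / K_cross B f)\<^sup>2 \<le> C\<^sup>2"
  \<comment> \<open>If the denominator is 0, the quotient is 0 by convention and the bound is
    trivial.\<close>
  proof (cases "K_cross B f = 0")
    case False
    have "0 \<le> C * K_cross B f" using nonneg[of 0] by simp
    then have "K_cross B f > 0" using False \<open>C > 0\<close> by (simp add: zero_le_mult_iff)
    then have "\<bar>K_cross J f / K_cross B f\<bar> \<le> C"
      using le by (simp add: field_simps)
    then show ?thesis using \<open>C > 0\<close> by (simp add: abs_le_square_iff[symmetric])
  qed simp
  then show ?thesis
    unfolding ARE_def by (rule mult_left_mono[OF _ K])
qed

theorem proposition2p3:
  fixes \<nu> :: real
  assumes "0 < \<nu>" and "\<nu> \<le> 1"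
  shows "(\<forall>f \<in> class_FJ (J_t \<nu>). symmetric_density f \<longrightarrow>
            ARE f (J_t \<nu>) J_W
              \<le> pi * (Gamma (\<nu> / 2))\<^sup>2 * (\<nu> + 3) * (\<nu> + 1)
                  / (12 * \<nu> * (Gamma ((\<nu> + 1) / 2))\<^sup>2))
       \<and> (\<forall>f \<in> class_FJ (J_t \<nu>) \<inter> class_FJ J_vdW. symmetric_density f \<longrightarrow>
            ARE f (J_t \<nu>) J_vdW
              \<le> (Gamma (\<nu> / 2))\<^sup>2 * (\<nu> + 3) * (\<nu> + 1)
                  / (2 * \<nu> * (Gamma ((\<nu> + 1) / 2))\<^sup>2))"
proof -
  \<comment> \<open>The derivative of the Student scores at 1/2: the Wilcoxon scores have slope 1,
    so this is their constant.\<close>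
  define C where "C = (\<nu> + 1) / (student_const \<nu> * \<nu>)"
  have c: "student_const \<nu> > 0" by (rule student_const_pos[OF assms(1)])
  then have "C > 0" using assms by (simp add: C_def)
  have G: "Gamma (\<nu> / 2) > 0" "Gamma ((\<nu> + 1) / 2) > 0" using assms by auto
  have "C\<^sup>2 = (\<nu> + 1)\<^sup>2 * (\<nu> * pi * (Gamma (\<nu> / 2))\<^sup>2) / (\<nu>\<^sup>2 * (Gamma ((\<nu> + 1) / 2))\<^sup>2)"
    using assms G by (simp add: C_def student_const_def power_divide power_mult_distrib)
  also have "\<dots> = (\<nu> + 1)\<^sup>2 * pi * (Gamma (\<nu> / 2))\<^sup>2 / (\<nu> * (Gamma ((\<nu> + 1) / 2))\<^sup>2)"
    using assms G by (simp add: power2_eq_square)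
  finally have C2: "C\<^sup>2 = (\<nu> + 1)\<^sup>2 * pi * (Gamma (\<nu> / 2))\<^sup>2 / (\<nu> * (Gamma ((\<nu> + 1) / 2))\<^sup>2)" .
  have W: "ARE f (J_t \<nu>) J_W \<le> K_score J_W / K_score (J_t \<nu>) * C\<^sup>2" if "f \<in> class_F0" for f
  proof (rule ARE_le[OF that \<open>C > 0\<close> _ K_score_t(1)[OF assms(1)] K_score_W(1)])
    show "\<bar>J_t \<nu> s - J_t \<nu> r\<bar> \<le> C * (J_W s - J_W r)" if "0 < r" "r \<le> s" "s < 1" for r s
      using J_t_lipschitz[OF assms that] by (simp add: C_def J_W_def)
    show "0 \<le> K_score J_W / K_score (J_t \<nu>)"
      using assms by (simp add: K_score_W(2) K_score_t(2))
  qed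
  \<comment> \<open>Chaining the Lipschitz bound with the expansion of the normal quantile divides C
    by sqrt (2 * pi); squaring cancels the factor pi in \<open>C\<^sup>2\<close> and leaves the 2 in
    the denominator.\<close>
  have V: "ARE f (J_t \<nu>) J_vdW \<le> K_score J_vdW / K_score (J_t \<nu>) * (C / sqrt (2 * pi))\<^sup>2" if "f \<in> class_F0" for f
  proof (rule ARE_le[OF that _ _ K_score_t(1)[OF assms(1)] K_score_vdW(1)])
    show "0 < C / sqrt (2 * pi)" using \<open>C > 0\<close> by simp
    show "\<bar>J_t \<nu> s - J_t \<nu> r\<bar> \<le> C / sqrt (2 * pi) * (J_vdW s - J_vdW r)" if "0 < r" "r \<le> s" "s < 1" for r s
    proof -
      have "\<bar>J_t \<nu> s - J_t \<nu> r\<bar> \<le> C * (s - r)"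
        using J_t_lipschitz[OF assms that] by (simp add: C_def)
      also have "\<dots> \<le> C * ((J_vdW s - J_vdW r) / sqrt (2 * pi))"
        using J_vdW_expanding[OF that] \<open>C > 0\<close> by (intro mult_left_mono) auto
      finally show ?thesis by simp
    qed
    show "0 \<le> K_score J_vdW / K_score (J_t \<nu>)"
      using assms by (simp add: K_score_vdW(2) K_score_t(2))
  qed
  have boundW: "K_score J_W / K_score (J_t \<nu>) * C\<^sup>2 = pi * (Gamma (\<nu> / 2))\<^sup>2 * (\<nu> + 3) * (\<nu> + 1)
      / (12 * \<nu> * (Gamma ((\<nu> + 1) / 2))\<^sup>2)"
  proof -
    have "1 / 12 / (m / (\<nu> + 3)) * (m\<^sup>2 * X / (\<nu> * Y)) = X * (\<nu> + 3) * m / (12 * \<nu> * Y)"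
      if "m > 0" "Y > 0" for m X Y
      using assms that by (simp add: power2_eq_square mult_ac)
    from this[of "\<nu> + 1" "(Gamma ((\<nu> + 1) / 2))\<^sup>2" "pi * (Gamma (\<nu> / 2))\<^sup>2"] show ?thesis
      unfolding C2 K_score_W(2) K_score_t(2)[OF assms(1)] using G assms by (simp only: mult.assoc zero_less_power)
  qed
  have boundV: "K_score J_vdW / K_score (J_t \<nu>) * (C / sqrt (2 * pi))\<^sup>2 = (Gamma (\<nu> / 2))\<^sup>2 * (\<nu> + 3) * (\<nu> + 1)
      / (2 * \<nu> * (Gamma ((\<nu> + 1) / 2))\<^sup>2)"
    unfolding power_divide C2 K_score_vdW(2) K_score_t(2)[OF assms(1)] using assms G by (simp add: power2_eq_square mult_ac)
  have "class_FJ J \<subseteq> class_F0" for J by (auto simp: class_FJ_def)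
  then show ?thesis
    using W V unfolding boundW boundV by blast
qed

end
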